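(* Fix $M>0$ and $\theta>1$. Then, uniformly over all $A,B,\Lambda,\Gamma\in\frac12\mathbb Z$ with $A\pm\Lambda\in\mathbb Z$, $B\pm\Gamma\in\mathbb Z$, $A>0$, $B\ge\theta A$, $|\Lambda|\le M\sqrt A$ and $|\Gamma|\le M\sqrt B$, \[ \Pr\bigl[BINGO(A+\Lambda,A-\Lambda;B+\Gamma,B-\Gamma)\bigr] =(1+o_A(1))\sqrt{\frac{2\alpha-1}{\pi}}\,\frac{A^{\alpha-1/2}}{B^\alpha\sqrt{1-(A/B)^{2\alpha-1}}} \exp\Bigl(-\frac{2\alpha-1}{1-(A/B)^{2\alpha-1}}\Bigl(\frac{\Lambda}{A^{1/2}}-\frac{\Gamma}{B^{\alpha}A^{1/2-\alpha}}\Bigr)^2\Bigr), \] where $o_A(1)$ denotes a quantity bounded in absolute value by $\varepsilon(A)$ for some function $\varepsilon$ (depending only on $\alpha,M,\theta$) with $\varepsilon(A)\to0$ as $A\to\infty$. (For $A$ large all coordinates involved are positive integers and the event is well defined.)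
   Context: Fix $\alpha>1$. Consider the Markov chain on $\mathbb N\times\mathbb N$ which from state $(i,j)$ moves to $(i+1,j)$ with probability $i^\alpha/(i^\alpha+j^\alpha)$ and to $(i,j+1)$ with probability $j^\alpha/(i^\alpha+j^\alpha)$. For $a\le c$, $b\le d$, $BINGO(a,b;c,d)$ denotes the event that this chain, started at state $(a,b)$, visits the state $(c,d)$ (and is the empty event if $(c,d)$ is not coordinatewise $\ge(a,b)$). *)

theory Defs
  imports "HOL-Probability.Probability"
begin

definition bingo_step :: "real \<Rightarrow> nat \<times> nat \<Rightarrow> (nat \<times> nat) pmf" where
  "bingo_step \<alpha> = (\<lambda>(i, j).
     map_pmf (\<lambda>h. if h then (i + 1, j) else (i, j + 1))
       (bernoulli_pmf (real i powr \<alpha> / (real i powr \<alpha> + real j powr \<alpha>))))"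

definition bingo_chain :: "real \<Rightarrow> nat \<times> nat \<Rightarrow> nat \<Rightarrow> (nat \<times> nat) pmf" where
  "bingo_chain \<alpha> s n = ((\<lambda>p. bind_pmf p (bingo_step \<alpha>)) ^^ n) (return_pmf s)"

text \<open>Probability of BINGO(a,b;c,d): the chain started at (a,b) visits (c,d).
  Since i+j increases by exactly one at each step, the events "X_n = (c,d)"
  are pairwise disjoint, so the visiting probability is the sum over n.\<close>
definition BINGO_prob :: "real \<Rightarrow> nat \<Rightarrow> nat \<Rightarrow> nat \<Rightarrow> nat \<Rightarrow> real" where
  "BINGO_prob \<alpha> a b c d = (\<Sum>n. pmf (bingo_chain \<alpha> (a, b) n) (c, d))"

end

theory Submission
  imports Defs
begin

text \<open>
  Run the two coordinates in continuous time as independent pure birth processes whose waiting time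
  at level \<open>k\<close> is exponential with rate \<open>k\<^sup>\<alpha>\<close>. The expected time spent
  at \<open>(c, d)\<close> shows that the visiting probability is \<open>c\<^sup>-\<^sup>\<alpha> + d\<^sup>-\<^sup>\<alpha>\<close> times the
  density at \<open>0\<close> of the difference of the two total waiting times up to and including levels
  \<open>c\<close> and \<open>d\<close>. By Fourier inversion this density is an integral of a product of factors
  \<open>1 / (1 \<mp> is/k\<^sup>\<alpha>)\<close>. The resulting formula satisfies the backward equation of the chain, so it can be
  verified without constructing the continuous-time process.

  After normalising by the variance \<open>V\<close>, the integrand is dominated by \<open>1 / (1 + s\<^sup>2/2)\<close> and
  converges to a Gaussian characteristic function, so the density is asymptotic to that of a normal
  variable; its mean and variance are evaluated by comparing sums with integrals. Uniformity follows
  by contradiction, from a sequence of parameters along which \<open>(A/B)\<^sup>2\<^sup>\<alpha>\<^sup>-\<^sup>1\<close> and the deviation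
  inside the exponential converge.
\<close>

section \<open>Characteristic functions of exponential variables\<close>

text \<open>Origin of the factor c^(-\<alpha>) + d^(-\<alpha>): given a visit to (c, d), the two
  waits at levels c and d overlap for an expected time 1/(c^\<alpha> + d^\<alpha>). On the other
  hand, the total wait through level c has at time t a density equal to c^\<alpha> times the
  probability of being at level c at time t, and similarly for d. Integrating over t, the expected
  overlap is c^(-\<alpha>) d^(-\<alpha>) times the density at 0 of the difference. Equating the two
  expressions gives the factor.

  The shaping obstacle is that B/A is unbounded. Hence (A/B)^(2\<alpha>-1) may tend to 0 along a
  sequence, so the probability and the main term are compared after multiplication by B^\<alpha>
  A^(1/2-\<alpha>), which gives both the same strictly positive limit. Moreover infinitely many
  parameters belong to a single A, and the error function has to be finite at every A, where a limit
  statement says nothing; a crude bound for fixed A, with both quantities of order B^(-\<alpha>),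
  fills this gap.\<close>

definition exp_char :: "real \<Rightarrow> complex" where
  "exp_char u = 1 / (1 - \<i> * complex_of_real u)"

lemma exp_char_denom_nonzero [simp]: "1 - \<i> * complex_of_real u \<noteq> 0"
  by (simp add: complex_eq_iff)

lemma norm_exp_char_denom: "norm (1 - \<i> * complex_of_real u) = sqrt (1 + u\<^sup>2)"
  by (simp add: cmod_def)

lemma norm_exp_char: "norm (exp_char u) = 1 / sqrt (1 + u\<^sup>2)"
  by (simp add: exp_char_def norm_divide norm_exp_char_denom)

lemma norm_exp_char_le_1: "norm (exp_char u) \<le> 1"
  by (simp add: norm_exp_char add_pos_nonneg)

lemma exp_char_Complex: "exp_char u = Complex (1 / (1 + u\<^sup>2)) (u / (1 + u\<^sup>2))"
  by (simp add: exp_char_def complex_eq_iff Re_divide Im_divide)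

lemma continuous_exp_char [continuous_intros]:
  "continuous_on S f \<Longrightarrow> continuous_on S (\<lambda>x. exp_char (f x))"
  unfolding exp_char_def by (intro continuous_intros) auto

text \<open>The comparison function belongs to the normal law with the same mean 1 and variance 1,
  so the discrepancy is of third order. The bound holds for every real \<open>u\<close>, hence no
  cut-off at small frequencies is needed later.\<close>

lemma norm_exp_char_minus_gaussian:
  "norm (exp_char u - exp (\<i> * complex_of_real u - complex_of_real (u\<^sup>2 / 2))) \<le> \<bar>u\<bar> ^ 3"
proof -
  \<comment> \<open>The derivative of \<open>(1 - iv) exp (iv - v\<^sup>2/2)\<close> is \<open>iv\<^sup>2 exp (iv - v\<^sup>2/2)\<close>: the lower-order terms cancel.\<close>
  define f where "f = (\<lambda>v::real. (1 - \<i> * complex_of_real v) * exp (\<i> * complex_of_real v - complex_of_real (v\<^sup>2 / 2)))"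
  have der: "(f has_vector_derivative (\<i> * complex_of_real (v\<^sup>2) * exp (\<i> * complex_of_real v - complex_of_real (v\<^sup>2 / 2)))) (at v within T)" for v T
  proof -
    have "((\<lambda>z::complex. (1 - \<i> * z) * exp (\<i> * z - z\<^sup>2 / 2)) has_field_derivative
       (\<i> * complex_of_real v ^ 2 * exp (\<i> * complex_of_real v - complex_of_real v ^ 2 / 2))) (at (complex_of_real v))"
      by (rule derivative_eq_intros refl | simp)+ (simp add: algebra_simps power2_eq_square)
    from has_vector_derivative_real_field[OF this, of T] show ?thesis
      by (simp add: f_def)
  qed
  have "norm (f u - f 0) \<le> u\<^sup>2 * norm (u - 0)"
  proof (rule differentiable_bound)
    show "convex (closed_segment 0 u)" by simp
    show "u \<in> closed_segment 0 u" "0 \<in> closed_segment 0 u" by auto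
    fix v assume v: "v \<in> closed_segment 0 u"
    show "(f has_derivative (\<lambda>h. h *\<^sub>R (\<i> * complex_of_real (v\<^sup>2) * exp (\<i> * complex_of_real v - complex_of_real (v\<^sup>2 / 2))))) (at v within closed_segment 0 u)"
      using der by (simp add: has_vector_derivative_def)
    have "\<bar>v\<bar> \<le> \<bar>u\<bar>" using v by (auto simp: closed_segment_eq_real_ivl split: if_splits)
    hence "v\<^sup>2 \<le> u\<^sup>2" by (simp add: abs_le_square_iff)
    have "norm (\<i> * complex_of_real (v\<^sup>2) * exp (\<i> * complex_of_real v - complex_of_real (v\<^sup>2 / 2))) = v\<^sup>2 * exp (- (v\<^sup>2/2))"
      by (simp add: norm_mult norm_power)
    also have "\<dots> \<le> v\<^sup>2 * 1" by (intro mult_left_mono) auto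
    also have "\<dots> \<le> u\<^sup>2" using \<open>v\<^sup>2 \<le> u\<^sup>2\<close> by simp
    finally show "onorm (\<lambda>h. h *\<^sub>R (\<i> * complex_of_real (v\<^sup>2) * exp (\<i> * complex_of_real v - complex_of_real (v\<^sup>2 / 2)))) \<le> u\<^sup>2"
      by (intro onorm_le) (simp only: norm_scaleR real_norm_def mult.commute[of "\<bar>_\<bar>"] mult_right_mono abs_ge_zero)
  qed
  hence f: "norm (f u - 1) \<le> \<bar>u\<bar> ^ 3"
    by (simp add: f_def power3_eq_cube power2_eq_square abs_mult [symmetric] mult.assoc)
  have "exp_char u - exp (\<i> * complex_of_real u - complex_of_real (u\<^sup>2 / 2)) = exp_char u * (1 - f u)"
    by (simp add: exp_char_def f_def field_simps)
  hence "norm (exp_char u - exp (\<i> * complex_of_real u - complex_of_real (u\<^sup>2 / 2))) \<le> norm (1 - f u)"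
    using mult_right_mono[OF norm_exp_char_le_1[of u], of "norm (1 - f u)"] by (simp add: norm_mult)
  with f show ?thesis by (simp add: norm_minus_commute)
qed

lemma integrable_inverse_1_plus_mult_square:
  assumes "q > 0"
  shows "integrable lborel (\<lambda>s::real. 1 / (1 + q * s\<^sup>2))"
proof -
  have "integrable lborel (\<lambda>s::real. inverse (1 + s\<^sup>2))"
    using integrable_inverse_1_plus_square by (simp add: set_integrable_def)
  from lborel_integrable_real_affine[OF this, of "sqrt q" 0] show ?thesis
    using assms by (simp add: power_mult_distrib inverse_eq_divide)
qed

text \<open>One factor decays only like 1/|s| and is not absolutely integrable; a second one gives
  decay s^(-2). This is why every integral below has at least two factors.\<close>

lemma norm_exp_char_mult_le:
  assumes "0 < \<sigma>" "\<sigma> \<le> \<bar>\<sigma>1\<bar>" "\<sigma> \<le> \<bar>\<sigma>2\<bar>"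
  shows "norm (exp_char (s * \<sigma>1) * exp_char (s * \<sigma>2)) \<le> 1 / (1 + \<sigma>\<^sup>2 * s\<^sup>2)"
proof -
  have *: "norm (exp_char (s * t)) \<le> 1 / sqrt (1 + \<sigma>\<^sup>2 * s\<^sup>2)" if "\<sigma> \<le> \<bar>t\<bar>" for t
  proof -
    have "\<sigma>\<^sup>2 \<le> t\<^sup>2" using that assms by (simp add: abs_le_square_iff [symmetric])
    hence "\<sigma>\<^sup>2 * s\<^sup>2 \<le> (s * t)\<^sup>2" by (simp add: power_mult_distrib mult.commute[of "s\<^sup>2"] mult_right_mono)
    thus ?thesis unfolding norm_exp_char
      by (intro divide_left_mono) (auto simp: add_pos_nonneg)
  qed
  have "norm (exp_char (s * \<sigma>1) * exp_char (s * \<sigma>2)) \<le> 1 / sqrt (1 + \<sigma>\<^sup>2 * s\<^sup>2) * (1 / sqrt (1 + \<sigma>\<^sup>2 * s\<^sup>2))"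
    unfolding norm_mult by (intro mult_mono * assms) auto
  also have "\<dots> = 1 / (1 + \<sigma>\<^sup>2 * s\<^sup>2)"
    by (simp add: add_nonneg_nonneg)
  finally show ?thesis .
qed

text \<open>Partial fractions give the antiderivative in terms of arctangents and logarithms. For equal signs the
  integral vanishes, for opposite signs it is the value at the final state of the chain.\<close>

lemma integral_exp_char_mult:
  assumes "\<sigma> \<noteq> 0" "\<tau> \<noteq> 0" "\<sigma> \<noteq> \<tau>"
  shows "(LINT s|lborel. exp_char (s * \<sigma>) * exp_char (s * \<tau>)) = complex_of_real (pi * (sgn \<sigma> - sgn \<tau>) / (\<sigma> - \<tau>))"
proof -
  define F where "F = (\<lambda>s. Complex ((arctan (s * \<sigma>) - arctan (s * \<tau>)) / (\<sigma> - \<tau>))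
     ((ln (1 + (s * \<sigma>)\<^sup>2) - ln (1 + (s * \<tau>)\<^sup>2)) / 2 / (\<sigma> - \<tau>)))"
  define L where "L = ln (\<sigma>\<^sup>2 / \<tau>\<^sup>2) / 2 / (\<sigma> - \<tau>)"
  have int: "integrable lborel (\<lambda>s. exp_char (s * \<sigma>) * exp_char (s * \<tau>))"
  proof (rule Bochner_Integration.integrable_bound)
    show "integrable lborel (\<lambda>s::real. 1 / (1 + (min \<bar>\<sigma>\<bar> \<bar>\<tau>\<bar>)\<^sup>2 * s\<^sup>2))"
      by (rule integrable_inverse_1_plus_mult_square) (use assms in auto)
    show "AE s in lborel. norm (exp_char (s * \<sigma>) * exp_char (s * \<tau>)) \<le> norm (1 / (1 + (min \<bar>\<sigma>\<bar> \<bar>\<tau>\<bar>)\<^sup>2 * s\<^sup>2))"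
      using assms by (intro always_eventually allI order.trans[OF norm_exp_char_mult_le[of "min \<bar>\<sigma>\<bar> \<bar>\<tau>\<bar>"]]) auto
    show "(\<lambda>s. exp_char (s * \<sigma>) * exp_char (s * \<tau>)) \<in> borel_measurable lborel"
      by (simp, intro borel_measurable_continuous_onI continuous_intros)
  qed
  \<comment> \<open>Each logarithm diverges, but their difference converges, and to the same value
    at both ends of the line (\<open>FF\<close> is either end). The imaginary parts therefore
    cancel, and only the arctangents contribute.\<close>
  have lnlim: "((\<lambda>s. ln (1 + (s * \<sigma>)\<^sup>2) - ln (1 + (s * \<tau>)\<^sup>2)) \<longlongrightarrow> ln (\<sigma>\<^sup>2 / \<tau>\<^sup>2)) FF"
    if FF: "filterlim (\<lambda>s::real. s) at_infinity FF" for FF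
  proof -
    have inv: "((\<lambda>s. inverse s) \<longlongrightarrow> 0) FF"
      by (rule filterlim_compose[OF tendsto_inverse_0 FF])
    have "((\<lambda>s. ln (((inverse s)\<^sup>2 + \<sigma>\<^sup>2) / ((inverse s)\<^sup>2 + \<tau>\<^sup>2))) \<longlongrightarrow> ln ((0\<^sup>2 + \<sigma>\<^sup>2) / (0\<^sup>2 + \<tau>\<^sup>2))) FF"
      using assms by (intro tendsto_intros inv) auto
    moreover have "\<forall>\<^sub>F s in FF. ln (((inverse s)\<^sup>2 + \<sigma>\<^sup>2) / ((inverse s)\<^sup>2 + \<tau>\<^sup>2)) = ln (1 + (s * \<sigma>)\<^sup>2) - ln (1 + (s * \<tau>)\<^sup>2)"
    proof -
      have "\<forall>\<^sub>F s in FF. s \<noteq> 0"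
        using filterlim_at_infinity_imp_eventually_ne[OF FF, of 0] .
      thus ?thesis
      proof (rule eventually_mono)
        fix s :: real assume s: "s \<noteq> 0"
        have e: "(inverse s)\<^sup>2 + x\<^sup>2 = (1 + (s * x)\<^sup>2) / s\<^sup>2" for x
          using s by (simp add: field_simps)
        have "((inverse s)\<^sup>2 + \<sigma>\<^sup>2) / ((inverse s)\<^sup>2 + \<tau>\<^sup>2) = (1 + (s * \<sigma>)\<^sup>2) / (1 + (s * \<tau>)\<^sup>2)"
          using s unfolding e by simp
        thus "ln (((inverse s)\<^sup>2 + \<sigma>\<^sup>2) / ((inverse s)\<^sup>2 + \<tau>\<^sup>2)) = ln (1 + (s * \<sigma>)\<^sup>2) - ln (1 + (s * \<tau>)\<^sup>2)"
          by (simp add: ln_div add_pos_nonneg add_nonneg_eq_0_iff)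
      qed
    qed
    ultimately show ?thesis by (simp add: tendsto_cong)
  qed
  have at_top: "((\<lambda>s. arctan (s * x)) \<longlongrightarrow> pi / 2 * sgn x) at_top" if "x \<noteq> 0" for x
  proof (cases "x > 0")
    case True
    hence "filterlim (\<lambda>s. s * x) at_top at_top"
      by (intro filterlim_at_top_mult_tendsto_pos[OF tendsto_const] filterlim_ident)
    from filterlim_compose[OF tendsto_arctan_at_top this] True show ?thesis by simp
  next
    case False
    hence "x < 0" using that by simp
    hence "filterlim (\<lambda>s. s * x) at_bot at_top"
      by (subst mult.commute, intro filterlim_tendsto_neg_mult_at_bot[OF tendsto_const] filterlim_ident)
    from filterlim_compose[OF tendsto_arctan_at_bot this] \<open>x < 0\<close> show ?thesis by simp
  qed
  have at_bot: "((\<lambda>s. arctan (s * x)) \<longlongrightarrow> - (pi / 2 * sgn x)) at_bot" if "x \<noteq> 0" for x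
    using tendsto_minus[OF at_top[OF that]] by (simp add: filterlim_at_bot_mirror arctan_minus)
  have "(LBINT s=-\<infinity>..\<infinity>. exp_char (s * \<sigma>) * exp_char (s * \<tau>)) =
     Complex ((pi / 2 * sgn \<sigma> - pi / 2 * sgn \<tau>) / (\<sigma> - \<tau>)) L
     - Complex ((- (pi / 2 * sgn \<sigma>) - - (pi / 2 * sgn \<tau>)) / (\<sigma> - \<tau>)) L"
  proof (rule interval_integral_FTC_integrable[where F = F])
    fix s :: real
    have 1: "1 + (s * x)\<^sup>2 > 0" for x by (simp add: add_pos_nonneg)
    have "(F has_vector_derivative Complex ((inverse (1 + (s * \<sigma>)\<^sup>2) * \<sigma> - inverse (1 + (s * \<tau>)\<^sup>2) * \<tau>) / (\<sigma> - \<tau>))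
        ((2 * (\<sigma> * (s * \<sigma>)) / (1 + (s * \<sigma>)\<^sup>2) - 2 * (\<tau> * (s * \<tau>)) / (1 + (s * \<tau>)\<^sup>2)) / 2 / (\<sigma> - \<tau>))) (at s)"
      unfolding F_def
      by (rule has_vector_derivative_complex_iff[THEN iffD2])
         (use 1 assms in \<open>auto intro!: derivative_eq_intros\<close>)
    moreover have "Complex ((inverse (1 + (s * \<sigma>)\<^sup>2) * \<sigma> - inverse (1 + (s * \<tau>)\<^sup>2) * \<tau>) / (\<sigma> - \<tau>))
        ((2 * (\<sigma> * (s * \<sigma>)) / (1 + (s * \<sigma>)\<^sup>2) - 2 * (\<tau> * (s * \<tau>)) / (1 + (s * \<tau>)\<^sup>2)) / 2 / (\<sigma> - \<tau>))
        = exp_char (s * \<sigma>) * exp_char (s * \<tau>)"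
    proof -
      define p q where "p = 1 + (s * \<sigma>)\<^sup>2" and "q = 1 + (s * \<tau>)\<^sup>2"
      have pq: "p > 0" "q > 0" by (simp_all add: 1 p_def q_def)
      have "(1 / p * \<sigma> - 1 / q * \<tau>) / (\<sigma> - \<tau>) = 1 / p * (1 / q) - s * \<sigma> / p * (s * \<tau> / q)"
        using pq assms by (simp add: field_simps) (simp add: p_def q_def algebra_simps power2_eq_square)
      moreover have "(2 * (\<sigma> * (s * \<sigma>)) / p - 2 * (\<tau> * (s * \<tau>)) / q) / 2 / (\<sigma> - \<tau>) = 1 / p * (s * \<tau> / q) + s * \<sigma> / p * (1 / q)"
        using pq assms by (simp add: field_simps) (simp add: p_def q_def algebra_simps power2_eq_square)
      ultimately show ?thesis
        by (simp add: exp_char_Complex complex_eq_iff inverse_eq_divide flip: p_def q_def)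
    qed
    ultimately show "(F has_vector_derivative exp_char (s * \<sigma>) * exp_char (s * \<tau>)) (at s)" by simp
    show "isCont (\<lambda>s. exp_char (s * \<sigma>) * exp_char (s * \<tau>)) s"
      unfolding exp_char_def by (intro continuous_intros) auto
  next
    show "set_integrable lborel (einterval (- \<infinity>) \<infinity>) (\<lambda>s. exp_char (s * \<sigma>) * exp_char (s * \<tau>))"
      using int by (simp add: set_integrable_def)
    show "((F \<circ> real_of_ereal) \<longlongrightarrow> Complex ((- (pi / 2 * sgn \<sigma>) - - (pi / 2 * sgn \<tau>)) / (\<sigma> - \<tau>)) L) (at_right (- \<infinity>))"
      unfolding ereal_tendsto_simps F_def L_def
      using assms by (intro tendsto_intros at_bot lnlim filterlim_mono[OF filterlim_ident at_bot_le_at_infinity order.refl]) auto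
    show "((F \<circ> real_of_ereal) \<longlongrightarrow> Complex ((pi / 2 * sgn \<sigma> - pi / 2 * sgn \<tau>) / (\<sigma> - \<tau>)) L) (at_left \<infinity>)"
      unfolding ereal_tendsto_simps F_def L_def
      using assms by (intro tendsto_intros at_top lnlim filterlim_mono[OF filterlim_ident at_top_le_at_infinity order.refl]) auto
  qed auto
  also have "\<dots> = complex_of_real (pi * (sgn \<sigma> - sgn \<tau>) / (\<sigma> - \<tau>))"
    unfolding complex_diff complex_of_real_def diff_divide_distrib [symmetric] by (simp add: algebra_simps)
  finally show ?thesis
    by (simp add: interval_lebesgue_integral_def set_lebesgue_integral_def)
qed

section \<open>The Fourier formula for the visiting probability\<close>

text \<open>This is the characteristic function of a sum of independent variables
  \<open>\<tau> i\<close> times a standard exponential; a negative \<open>\<tau> i\<close>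
  represents a subtracted waiting time.\<close>

definition exp_char_prod :: "('i \<Rightarrow> real) \<Rightarrow> 'i set \<Rightarrow> real \<Rightarrow> complex" where
  "exp_char_prod \<tau> I s = (\<Prod>i\<in>I. exp_char (s * \<tau> i))"

lemma measurable_exp_char_prod [measurable]: "exp_char_prod \<tau> I \<in> borel_measurable borel"
  unfolding exp_char_prod_def by (intro borel_measurable_continuous_onI continuous_intros)

lemma exp_char_prod_remove:
  assumes "finite I" "i \<in> I"
  shows "exp_char_prod \<tau> (I - {i}) s = (1 - \<i> * complex_of_real (s * \<tau> i)) * exp_char_prod \<tau> I s"
  unfolding exp_char_prod_def prod.remove[OF assms] by (simp only: exp_char_def) simp

lemma norm_exp_char_prod_le:
  assumes "finite I" "i \<in> I" "j \<in> I" "i \<noteq> j" "0 < \<sigma>" "\<sigma> \<le> \<bar>\<tau> i\<bar>" "\<sigma> \<le> \<bar>\<tau> j\<bar>"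
  shows "norm (exp_char_prod \<tau> I s) \<le> 1 / (1 + \<sigma>\<^sup>2 * s\<^sup>2)"
proof -
  have "exp_char_prod \<tau> I s = exp_char (s * \<tau> i) * exp_char (s * \<tau> j) * (\<Prod>k\<in>I - {i} - {j}. exp_char (s * \<tau> k))"
    unfolding exp_char_prod_def using assms
    by (subst prod.remove[of I i], simp, simp, subst prod.remove[of "I - {i}" j]) (auto simp: mult_ac)
  also have "norm \<dots> \<le> 1 / (1 + \<sigma>\<^sup>2 * s\<^sup>2) * 1"
    unfolding norm_mult[of "_ * _" "prod _ _"]
    by (intro mult_mono norm_exp_char_mult_le assms)
       (auto simp: prod_norm [symmetric] norm_exp_char_le_1 intro!: prod_le_1 prod_nonneg)
  finally show ?thesis by simp
qed

lemma integrable_exp_char_prod: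
  assumes "card I \<ge> 2" "\<And>i. i \<in> I \<Longrightarrow> \<tau> i \<noteq> 0"
  shows "integrable lborel (exp_char_prod \<tau> I)"
proof -
  have fin: "finite I" using assms(1) by (metis card.infinite not_numeral_le_zero)
  obtain i j where ij: "i \<in> I" "j \<in> I" "i \<noteq> j"
    using assms(1) fin by (metis card_le_Suc0_iff_eq not_less_eq_eq numeral_2_eq_2)
  define \<sigma> where "\<sigma> = min \<bar>\<tau> i\<bar> \<bar>\<tau> j\<bar>"
  have \<sigma>: "\<sigma> > 0" using ij assms by (auto simp: \<sigma>_def)
  show ?thesis
  proof (rule Bochner_Integration.integrable_bound)
    show "integrable lborel (\<lambda>s::real. 1 / (1 + \<sigma>\<^sup>2 * s\<^sup>2))"
      by (rule integrable_inverse_1_plus_mult_square) (use \<sigma> in auto)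
    show "AE s in lborel. norm (exp_char_prod \<tau> I s) \<le> norm (1 / (1 + \<sigma>\<^sup>2 * s\<^sup>2))"
      using ij fin \<sigma> by (intro always_eventually allI order.trans[OF norm_exp_char_prod_le[of I i j \<sigma>]])
                     (auto simp: \<sigma>_def)
  qed simp
qed

text \<open>Removing a factor multiplies the product by its denominator, and \<tau>_i (1 - is
  \<tau>_j) - \<tau>_j (1 - is \<tau>_i) = \<tau>_i - \<tau>_j.\<close>

lemma exp_char_prod_partial_fraction:
  assumes "finite I" "i \<in> I" "j \<in> I"
  shows "complex_of_real (\<tau> i - \<tau> j) * exp_char_prod \<tau> I s =
    complex_of_real (\<tau> i) * exp_char_prod \<tau> (I - {j}) s - complex_of_real (\<tau> j) * exp_char_prod \<tau> (I - {i}) s"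
  using assms by (simp add: exp_char_prod_remove algebra_simps)

text \<open>Up to 2 pi this is the density at 0 of a sum of at least two exponential variables of
  one sign, which vanishes there. Partial fractions lower the number of factors down to the explicit
  case of two; injectivity permits the division by \<tau>_i - \<tau>_j.\<close>

lemma integral_exp_char_prod_eq_0:
  assumes "card I \<ge> 2" "inj_on \<tau> I" "\<And>i. i \<in> I \<Longrightarrow> sgn (\<tau> i) = \<epsilon>" "\<epsilon> \<noteq> 0"
  shows "(LINT s|lborel. exp_char_prod \<tau> I s) = 0"
  using assms(1-3)
proof (induction "card I" arbitrary: I rule: less_induct)
  case less
  have fin: "finite I" using less.prems(1) by (metis card.infinite not_numeral_le_zero)
  obtain i j where ij: "i \<in> I" "j \<in> I" "i \<noteq> j"
    using less.prems(1) fin by (metis card_le_Suc0_iff_eq not_less_eq_eq numeral_2_eq_2)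
  have nz: "\<tau> k \<noteq> 0" if "k \<in> I" for k using less.prems(3)[OF that] assms(4) by auto
  have ne: "\<tau> i \<noteq> \<tau> j" using ij less.prems(2) by (auto dest: inj_onD)
  show ?case
  proof (cases "card I = 2")
    case True
    hence "I = {i, j}" using ij fin by (metis card_2_iff doubleton_eq_iff insert_iff empty_iff)
    thus ?thesis using ij ne nz less.prems(3) integral_exp_char_mult[of "\<tau> i" "\<tau> j"]
      by (simp add: exp_char_prod_def [abs_def])
  next
    case False
    have rem: "integrable lborel (exp_char_prod \<tau> (I - {k}))" "(LINT s|lborel. exp_char_prod \<tau> (I - {k}) s) = 0"
      if "k \<in> I" for k
    proof -
      have "card (I - {k}) \<ge> 2" "card (I - {k}) < card I" using that fin False less.prems(1) by auto
      thus "integrable lborel (exp_char_prod \<tau> (I - {k}))" "(LINT s|lborel. exp_char_prod \<tau> (I - {k}) s) = 0"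
        using nz less.prems(2,3) by (auto intro!: integrable_exp_char_prod less.hyps inj_on_diff)
    qed
    have "complex_of_real (\<tau> i - \<tau> j) * (LINT s|lborel. exp_char_prod \<tau> I s) =
      (LINT s|lborel. complex_of_real (\<tau> i) * exp_char_prod \<tau> (I - {j}) s - complex_of_real (\<tau> j) * exp_char_prod \<tau> (I - {i}) s)"
      using ij fin by (subst exp_char_prod_partial_fraction [symmetric]) auto
    also have "\<dots> = 0"
      using ij rem by (subst Bochner_Integration.integral_diff) auto
    finally show ?thesis using ne by simp
  qed
qed

text \<open>The left summand of the index type labels the waiting times of the first coordinate, the right summand
  those of the second, which enter the difference with a negative sign.\<close>

definition signed_rate :: "real \<Rightarrow> nat + nat \<Rightarrow> real" where
  "signed_rate \<alpha> = case_sum (\<lambda>k. real k powr - \<alpha>) (\<lambda>k. - (real k powr - \<alpha>))"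

lemma signed_rate_simps [simp]:
  "signed_rate \<alpha> (Inl k) = real k powr - \<alpha>"
  "signed_rate \<alpha> (Inr k) = - (real k powr - \<alpha>)"
  by (simp_all add: signed_rate_def)

text \<open>By Fourier inversion, 2 pi times the density at 0 of the difference of the waiting
  times, levels c and d included.\<close>

definition bingo_integral :: "real \<Rightarrow> nat \<Rightarrow> nat \<Rightarrow> nat \<Rightarrow> nat \<Rightarrow> complex" where
  "bingo_integral \<alpha> a b c d = (LINT s|lborel. exp_char_prod (signed_rate \<alpha>) ({a..c} <+> {b..d}) s)"

section \<open>The Fourier integral as a function of the starting state\<close>

lemma powr_neg_inj:
  assumes "\<alpha> > 0" "x > 0" "y > 0" "x powr - \<alpha> = y powr - (\<alpha>::real)"
  shows "x = (y::real)"
  using assms by (metis less_irrefl linorder_neqE_linordered_idom neg_less_0_iff_less powr_less_mono2_neg)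

text \<open>The integrands already agree pointwise. Deleting level a or b multiplies the product by
  1 - is a^(-\<alpha>) or 1 + is b^(-\<alpha>), and p a^(-\<alpha>) = (1 - p) b^(-\<alpha>), so the
  weighted multipliers add up to 1. Away from the endpoint each reduced product still has two
  factors and is integrable.\<close>

lemma bingo_integral_recursion:
  fixes \<alpha> :: real
  assumes "a \<ge> 1" "b \<ge> 1" "a \<le> c" "b \<le> d" "(a, b) \<noteq> (c, d)"
  defines "p \<equiv> real a powr \<alpha> / (real a powr \<alpha> + real b powr \<alpha>)"
  shows "bingo_integral \<alpha> a b c d =
    complex_of_real p * bingo_integral \<alpha> (a + 1) b c d + complex_of_real (1 - p) * bingo_integral \<alpha> a (b + 1) c d"
proof -
  let ?I = "{a..c} <+> {b..d}"
  have I1: "{a+1..c} <+> {b..d} = ?I - {Inl a}" and I2: "{a..c} <+> {b+1..d} = ?I - {Inr b}"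
    using assms by auto
  have int: "integrable lborel (exp_char_prod (signed_rate \<alpha>) ({a'..c} <+> {b'..d}))"
    if "(Suc c - a') + (Suc d - b') \<ge> 2" "a' \<ge> 1" "b' \<ge> 1" for a' b'
    by (rule integrable_exp_char_prod) (use that in \<open>auto simp: card_Plus\<close>)
  define x y where "x = real a powr \<alpha>" and "y = real b powr \<alpha>"
  have xy: "x > 0" "y > 0" using assms by (auto simp: x_def y_def)
  have pxy: "p = x / (x + y)" "1 - p = y / (x + y)" using xy 
    unfolding p_def x_def [symmetric] y_def [symmetric] by (simp_all add: field_simps)
  have ident: "complex_of_real p * (1 - \<i> * complex_of_real (s * real a powr - \<alpha>))
      + complex_of_real (1 - p) * (1 + \<i> * complex_of_real (s * real b powr - \<alpha>)) = 1" for s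
  proof -
    have "p * (s * real a powr - \<alpha>) = (1 - p) * (s * real b powr - \<alpha>)"
      unfolding pxy using xy by (simp add: powr_minus x_def [symmetric] y_def [symmetric] field_simps)
    thus ?thesis
      by (simp add: complex_eq_iff del: mult_cancel_left mult_cancel_right mult_eq_0_iff) (auto simp: algebra_simps)
  qed
  have "complex_of_real p * bingo_integral \<alpha> (a + 1) b c d + complex_of_real (1 - p) * bingo_integral \<alpha> a (b + 1) c d
    = (LINT s|lborel. complex_of_real p * exp_char_prod (signed_rate \<alpha>) ({a+1..c} <+> {b..d}) s
        + complex_of_real (1 - p) * exp_char_prod (signed_rate \<alpha>) ({a..c} <+> {b+1..d}) s)"
    unfolding bingo_integral_def
    by (subst Bochner_Integration.integral_add)
       (use assms(1-5) in \<open>auto intro!: int integrable_mult_right\<close>)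
  also have "\<dots> = bingo_integral \<alpha> a b c d"
    unfolding bingo_integral_def
  proof (rule Bochner_Integration.integral_cong, rule refl)
    fix s
    have "complex_of_real p * exp_char_prod (signed_rate \<alpha>) ({a+1..c} <+> {b..d}) s
        + complex_of_real (1 - p) * exp_char_prod (signed_rate \<alpha>) ({a..c} <+> {b+1..d}) s
       = (complex_of_real p * (1 - \<i> * complex_of_real (s * real a powr - \<alpha>))
      + complex_of_real (1 - p) * (1 + \<i> * complex_of_real (s * real b powr - \<alpha>))) * exp_char_prod (signed_rate \<alpha>) ?I s"
    proof -
      have "exp_char_prod (signed_rate \<alpha>) (?I - {Inl a}) s = (1 - \<i> * complex_of_real (s * real a powr - \<alpha>)) * exp_char_prod (signed_rate \<alpha>) ?I s"
        using assms(1-5) by (subst exp_char_prod_remove) auto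
      moreover have "exp_char_prod (signed_rate \<alpha>) (?I - {Inr b}) s = (1 + \<i> * complex_of_real (s * real b powr - \<alpha>)) * exp_char_prod (signed_rate \<alpha>) ?I s"
        using assms(1-5) by (subst exp_char_prod_remove) auto
      ultimately show ?thesis
        unfolding I1 I2 by (simp only: distrib_right mult.assoc)
    qed
    thus "complex_of_real p * exp_char_prod (signed_rate \<alpha>) ({a+1..c} <+> {b..d}) s
        + complex_of_real (1 - p) * exp_char_prod (signed_rate \<alpha>) ({a..c} <+> {b+1..d}) s = exp_char_prod (signed_rate \<alpha>) ?I s"
      by (simp only: ident mult_1_left)
  qed
  finally show ?thesis ..
qed

text \<open>Once one coordinate has passed its target, its block of factors is empty and all
  remaining signs agree. The strict inequality guarantees two remaining factors.\<close>

lemma bingo_integral_boundary: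
  assumes "\<alpha> > 0" "a \<ge> 1" "b \<ge> 1"
  shows "a < c \<Longrightarrow> bingo_integral \<alpha> a (Suc d) c d = 0"
    and "b < d \<Longrightarrow> bingo_integral \<alpha> (Suc c) b c d = 0"
proof -
  have inj: "real x powr - \<alpha> = real y powr - \<alpha> \<Longrightarrow> x = y" if "x > 0" "y > 0" for x y :: nat
    using powr_neg_inj[of \<alpha> "real x" "real y"] that assms by simp
  show "bingo_integral \<alpha> a (Suc d) c d = 0" if "a < c" unfolding bingo_integral_def
    by (rule integral_exp_char_prod_eq_0[where \<epsilon> = 1])
       (use that assms in \<open>auto simp: card_Plus inj_on_def intro: inj\<close>)
  show "bingo_integral \<alpha> (Suc c) b c d = 0" if "b < d" unfolding bingo_integral_def
    by (rule integral_exp_char_prod_eq_0[where \<epsilon> = "-1"])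
       (use that assms in \<open>auto simp: card_Plus inj_on_def intro: inj\<close>)
qed

text \<open>This value fixes the normalisation: it makes the formula equal to 1 when the chain
  starts at its target.\<close>

lemma bingo_integral_endpoint:
  assumes "c \<ge> 1" "d \<ge> 1"
  shows "bingo_integral \<alpha> c d c d = complex_of_real (2 * pi / (real c powr - \<alpha> + real d powr - \<alpha>))"
proof -
  have "real c powr - \<alpha> > 0" "real d powr - \<alpha> > 0" using assms by auto
  moreover have "exp_char_prod (signed_rate \<alpha>) ({c..c} <+> {d..d}) = (\<lambda>s. exp_char (s * real c powr - \<alpha>) * exp_char (s * - (real d powr - \<alpha>)))"
    by (simp add: exp_char_prod_def fun_eq_iff prod.Plus)
  moreover from calculation have "real c powr - \<alpha> \<noteq> - (real d powr - \<alpha>)" by linarith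
  ultimately show ?thesis
    unfolding bingo_integral_def
    using integral_exp_char_mult[of "real c powr - \<alpha>" "- (real d powr - \<alpha>)"] assms by (simp add: mult.commute)
qed

text \<open>The definition appends steps at the end, whereas the backward equation needs the first
  step split off.\<close>

lemma bingo_chain_Suc: "bingo_chain \<alpha> s (Suc n) = bind_pmf (bingo_step \<alpha> s) (\<lambda>s'. bingo_chain \<alpha> s' n)"
proof -
  have *: "((\<lambda>p. bind_pmf p (bingo_step \<alpha>)) ^^ n) q = bind_pmf q (\<lambda>s'. bingo_chain \<alpha> s' n)" for q
    by (induction n) (simp_all add: bingo_chain_def bind_return_pmf' bind_assoc_pmf)
  show ?thesis
    by (simp add: bingo_chain_def[of \<alpha> s "Suc n"] funpow_Suc_right bind_return_pmf * del: funpow.simps)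
qed

lemma pmf_bingo_chain_Suc:
  fixes a b :: nat and \<alpha> :: real
  defines "p \<equiv> real a powr \<alpha> / (real a powr \<alpha> + real b powr \<alpha>)"
  shows "pmf (bingo_chain \<alpha> (a, b) (Suc n)) x =
    p * pmf (bingo_chain \<alpha> (a + 1, b) n) x + (1 - p) * pmf (bingo_chain \<alpha> (a, b + 1) n) x"
proof -
  have "x / (x + y) \<in> {0..1}" if "x \<ge> 0" "y \<ge> 0" for x y :: real
    using that by (cases "x + y = 0") (auto simp: divide_le_eq_1)
  hence "p \<in> {0..1}" by (simp add: p_def)
  thus ?thesis
    unfolding bingo_chain_Suc bingo_step_def
    by (simp add: bind_map_pmf pmf_bind integral_measure_pmf_real[where A = "UNIV"] UNIV_bool p_def[symmetric])
qed

text \<open>Both sides obey the same first-step recursion and initial condition. The integral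
  carries no time variable: since i + j grows by one per step, the time of a visit is determined by
  the endpoints.\<close>

lemma pmf_bingo_chain_eq:
  assumes "\<alpha> > 0" "a \<ge> 1" "b \<ge> 1" "c \<ge> 1" "d \<ge> 1"
  shows "complex_of_real (pmf (bingo_chain \<alpha> (a, b) n) (c, d)) =
    (if a \<le> c \<and> b \<le> d \<and> a + b + n = c + d
     then complex_of_real ((real c powr - \<alpha> + real d powr - \<alpha>) / (2 * pi)) * bingo_integral \<alpha> a b c d else 0)"
  using assms(2,3)
proof (induction n arbitrary: a b)
  case 0
  have "real c powr - \<alpha> > 0" "real d powr - \<alpha> > 0" using assms by auto
  hence "real c powr - \<alpha> + real d powr - \<alpha> \<noteq> 0" by linarith
  hence "complex_of_real ((real c powr - \<alpha> + real d powr - \<alpha>) / (2 * pi)) * bingo_integral \<alpha> c d c d = 1"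
    unfolding bingo_integral_endpoint[OF assms(4,5)] of_real_mult [symmetric] by simp
  moreover have "a \<le> c \<and> b \<le> d \<and> a + b + 0 = c + d \<longleftrightarrow> (a, b) = (c, d)" by auto
  ultimately show ?case
    by (auto simp: bingo_chain_def)
next
  case (Suc n)
  let ?\<kappa> = "complex_of_real ((real c powr - \<alpha> + real d powr - \<alpha>) / (2 * pi))"
  let ?p = "real a powr \<alpha> / (real a powr \<alpha> + real b powr \<alpha>)"
  have IH: "complex_of_real (pmf (bingo_chain \<alpha> (a, b) (Suc n)) (c, d)) =
     complex_of_real ?p * (if a + 1 \<le> c \<and> b \<le> d \<and> a + 1 + b + n = c + d then ?\<kappa> * bingo_integral \<alpha> (a + 1) b c d else 0)
     + complex_of_real (1 - ?p) * (if a \<le> c \<and> b + 1 \<le> d \<and> a + (b + 1) + n = c + d then ?\<kappa> * bingo_integral \<alpha> a (b + 1) c d else 0)"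
    unfolding pmf_bingo_chain_Suc of_real_add of_real_mult
    using Suc.prems by (subst (1 2) Suc.IH) auto
  show ?case
  proof (cases "a \<le> c \<and> b \<le> d \<and> a + b + Suc n = c + d")
    case True
    \<comment> \<open>If a = c, the conditional gives 0 because the step overshoots, and the
      boundary lemma gives 0 for the integral. The case distinction can thus be dropped before the
      recursion is applied.\<close>
    have 1: "(if a + 1 \<le> c \<and> b \<le> d \<and> a + 1 + b + n = c + d then ?\<kappa> * bingo_integral \<alpha> (a + 1) b c d else 0)
      = ?\<kappa> * bingo_integral \<alpha> (a + 1) b c d"
      using True Suc.prems assms bingo_integral_boundary(2)[of \<alpha> a b d c] by (cases "a = c") auto
    have 2: "(if a \<le> c \<and> b + 1 \<le> d \<and> a + (b + 1) + n = c + d then ?\<kappa> * bingo_integral \<alpha> a (b + 1) c d else 0)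
      = ?\<kappa> * bingo_integral \<alpha> a (b + 1) c d"
      using True Suc.prems assms bingo_integral_boundary(1)[of \<alpha> a b c d] by (cases "b = d") auto
    have "bingo_integral \<alpha> a b c d =
      complex_of_real ?p * bingo_integral \<alpha> (a + 1) b c d + complex_of_real (1 - ?p) * bingo_integral \<alpha> a (b + 1) c d"
      by (rule bingo_integral_recursion) (use True Suc.prems in auto)
    thus ?thesis using True unfolding IH 1 2 by (simp only: if_True distrib_left mult.left_commute simp_thms)
  next
    case False
    thus ?thesis unfolding IH by auto
  qed
qed

theorem BINGO_prob_eq_integral:
  assumes "\<alpha> > 0" "a \<ge> 1" "b \<ge> 1" "c \<ge> 1" "d \<ge> 1"
  shows "complex_of_real (BINGO_prob \<alpha> a b c d) =
    (if a \<le> c \<and> b \<le> d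
     then complex_of_real ((real c powr - \<alpha> + real d powr - \<alpha>) / (2 * pi)) * bingo_integral \<alpha> a b c d else 0)"
proof -
  have zero: "pmf (bingo_chain \<alpha> (a, b) n) (c, d) = 0" if "\<not> (a \<le> c \<and> b \<le> d \<and> a + b + n = c + d)" for n
    using pmf_bingo_chain_eq[OF assms, of n] that by (simp only: if_False of_real_eq_0_iff)
  \<comment> \<open>Only one time can contribute. If the truncated subtraction misrepresents it,
    then the target is unreachable and all terms are 0.\<close>
  have "BINGO_prob \<alpha> a b c d = (\<Sum>n\<in>{c + d - (a + b)}. pmf (bingo_chain \<alpha> (a, b) n) (c, d))"
    unfolding BINGO_prob_def by (rule suminf_finite) (auto intro!: zero)
  thus ?thesis
    using pmf_bingo_chain_eq[OF assms, of "c + d - (a + b)"] by auto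
qed

section \<open>A uniform local limit theorem\<close>

text \<open>Keeping the second elementary symmetric polynomial is what makes the dominating function decay like
  \<open>s\<^sup>-\<^sup>2\<close> and hence integrable.\<close>

lemma prod_1_plus_ge_second_order:
  fixes x :: "'i \<Rightarrow> real"
  assumes "finite I" "\<And>i. i \<in> I \<Longrightarrow> x i \<ge> 0"
  shows "1 + (\<Sum>i\<in>I. x i) + ((\<Sum>i\<in>I. x i)\<^sup>2 - (\<Sum>i\<in>I. (x i)\<^sup>2)) / 2 \<le> (\<Prod>i\<in>I. 1 + x i)"
proof -
  \<comment> \<open>The second conjunct strengthens the induction: adjoining \<open>j\<close>
    produces the extra term x_j (S^2 - Q)/2, which must be nonnegative to be discarded.\<close>
  have "1 + (\<Sum>i\<in>I. x i) + ((\<Sum>i\<in>I. x i)\<^sup>2 - (\<Sum>i\<in>I. (x i)\<^sup>2)) / 2 \<le> (\<Prod>i\<in>I. 1 + x i)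
      \<and> (\<Sum>i\<in>I. (x i)\<^sup>2) \<le> (\<Sum>i\<in>I. x i)\<^sup>2"
    using assms
  proof (induction I rule: finite_induct)
    case (insert j J)
    define S Q P where "S = (\<Sum>i\<in>J. x i)" and "Q = (\<Sum>i\<in>J. (x i)\<^sup>2)" and "P = (\<Prod>i\<in>J. 1 + x i)"
    have IH: "1 + S + (S\<^sup>2 - Q) / 2 \<le> P" "Q \<le> S\<^sup>2"
      using insert by (auto simp: S_def Q_def P_def)
    have S: "S \<ge> 0" unfolding S_def by (intro sum_nonneg) (use insert in auto)
    have xj: "x j \<ge> 0" using insert by simp
    have "1 + (x j + S) + ((x j + S)\<^sup>2 - ((x j)\<^sup>2 + Q)) / 2 + x j * ((S\<^sup>2 - Q) / 2) = (1 + x j) * (1 + S + (S\<^sup>2 - Q) / 2)"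
      by (simp add: field_simps power2_eq_square)
    also have "\<dots> \<le> (1 + x j) * P" using IH xj by (intro mult_left_mono) auto
    finally have "1 + (x j + S) + ((x j + S)\<^sup>2 - ((x j)\<^sup>2 + Q)) / 2 \<le> (1 + x j) * P"
      using mult_nonneg_nonneg[OF xj, of "(S\<^sup>2 - Q) / 2"] IH(2) by simp
    moreover have "(x j)\<^sup>2 + Q \<le> (x j + S)\<^sup>2" using IH(2) mult_nonneg_nonneg[OF xj S] by (simp add: power2_sum)
    ultimately show ?case using insert.hyps by (simp add: S_def Q_def P_def)
  qed auto
  thus ?thesis ..
qed

text \<open>With total variance 1 and each share at most 1/2, the second-order lower bound for the
  inverse squared modulus is 1 + s^2 + s^4/4, a perfect square. This is the origin of both constants
  1/2.\<close>

lemma norm_exp_char_prod_standardized_le: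
  assumes "finite I" "(\<Sum>i\<in>I. (\<tau> i)\<^sup>2) = 1" "\<And>i. i \<in> I \<Longrightarrow> (\<tau> i)\<^sup>2 \<le> 1 / 2"
  shows "norm (exp_char_prod \<tau> I s) \<le> 1 / (1 + 1 / 2 * s\<^sup>2)"
proof -
  define x where "x i = (s * \<tau> i)\<^sup>2" for i
  have S: "(\<Sum>i\<in>I. x i) = s\<^sup>2"
    using assms by (simp add: x_def power_mult_distrib sum_distrib_left [symmetric])
  have "(\<Sum>i\<in>I. (x i)\<^sup>2) \<le> (\<Sum>i\<in>I. s\<^sup>2 * (1 / 2) * x i)"
  proof (rule sum_mono)
    fix i assume "i \<in> I"
    hence "x i \<le> s\<^sup>2 * (1 / 2)"
      unfolding x_def power_mult_distrib by (intro mult_left_mono assms) auto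
    thus "(x i)\<^sup>2 \<le> s\<^sup>2 * (1 / 2) * x i"
      unfolding power2_eq_square[of "x i"] by (intro mult_right_mono) (auto simp: x_def)
  qed
  also have "\<dots> = s\<^sup>2 * s\<^sup>2 / 2" unfolding sum_distrib_left [symmetric] S by simp
  finally have Q: "(\<Sum>i\<in>I. (x i)\<^sup>2) \<le> s\<^sup>2 * s\<^sup>2 / 2" .
  have "(1 + 1 / 2 * s\<^sup>2)\<^sup>2 = 1 + s\<^sup>2 + (s\<^sup>2 * s\<^sup>2 - s\<^sup>2 * s\<^sup>2 / 2) / 2"
    by (simp add: power2_eq_square field_simps)
  also have "\<dots> \<le> (\<Prod>i\<in>I. 1 + x i)"
  proof -
    have "1 + s\<^sup>2 + (s\<^sup>2 * s\<^sup>2 - (\<Sum>i\<in>I. (x i)\<^sup>2)) / 2 \<le> (\<Prod>i\<in>I. 1 + x i)"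
      using prod_1_plus_ge_second_order[OF assms(1), of x] unfolding S power2_eq_square[of "s\<^sup>2"]
      by (simp add: x_def)
    thus ?thesis using Q by argo
  qed
  finally have "1 + 1 / 2 * s\<^sup>2 \<le> sqrt (\<Prod>i\<in>I. 1 + x i)"
    by (rule real_le_rsqrt)
  moreover have "norm (exp_char_prod \<tau> I s) = 1 / sqrt (\<Prod>i\<in>I. 1 + x i)"
  proof -
    have "sqrt (\<Prod>i\<in>I. 1 + x i) = (\<Prod>i\<in>I. sqrt (1 + x i))"
      using assms(1) by (induction I rule: finite_induct) (auto simp: real_sqrt_mult)
    thus ?thesis
      by (simp add: exp_char_prod_def prod_norm [symmetric] norm_exp_char x_def prod_dividef)
  qed
  moreover have "1 + 1 / 2 * s\<^sup>2 > 0" by (simp add: add_pos_nonneg)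
  ultimately show ?thesis by (simp add: frac_le)
qed

text \<open>Lindeberg's replacement argument: all factors have modulus at most 1, so the difference
  of products is at most the sum of the differences, each cubic, and one power of |\<tau>_i| is
  traded for \<delta> while the squares sum to 1.\<close>

lemma norm_exp_char_prod_minus_gaussian:
  assumes "finite I" "(\<Sum>i\<in>I. (\<tau> i)\<^sup>2) = 1" "\<And>i. i \<in> I \<Longrightarrow> \<bar>\<tau> i\<bar> \<le> \<delta>"
  shows "norm (exp_char_prod \<tau> I s - exp (\<i> * complex_of_real (s * (\<Sum>i\<in>I. \<tau> i)) - complex_of_real (s\<^sup>2 / 2))) \<le> \<delta> * \<bar>s\<bar> ^ 3"
proof -
  define w where "w i = exp (\<i> * complex_of_real (s * \<tau> i) - complex_of_real ((s * \<tau> i)\<^sup>2 / 2))" for i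
  have "(\<Sum>i\<in>I. \<i> * complex_of_real (s * \<tau> i) - complex_of_real ((s * \<tau> i)\<^sup>2 / 2))
      = \<i> * complex_of_real (\<Sum>i\<in>I. s * \<tau> i) - complex_of_real (\<Sum>i\<in>I. (s * \<tau> i)\<^sup>2 / 2)"
    by (simp add: sum_subtractf sum_distrib_left)
  also have "(\<Sum>i\<in>I. (s * \<tau> i)\<^sup>2 / 2) = s\<^sup>2 / 2"
    using assms(2) by (simp add: power_mult_distrib sum_distrib_left [symmetric] sum_divide_distrib [symmetric])
  finally have w: "(\<Prod>i\<in>I. w i) = exp (\<i> * complex_of_real (s * (\<Sum>i\<in>I. \<tau> i)) - complex_of_real (s\<^sup>2 / 2))"
    unfolding w_def using assms(1) by (simp add: exp_sum [symmetric] sum_distrib_left)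
  have "norm (exp_char_prod \<tau> I s - (\<Prod>i\<in>I. w i)) \<le> (\<Sum>i\<in>I. norm (exp_char (s * \<tau> i) - w i))"
    unfolding exp_char_prod_def
    by (rule norm_prod_diff) (auto simp: norm_exp_char_le_1 w_def)
  also have "\<dots> \<le> (\<Sum>i\<in>I. \<delta> * \<bar>s\<bar> ^ 3 * (\<tau> i)\<^sup>2)"
  proof (rule sum_mono)
    fix i assume i: "i \<in> I"
    have "norm (exp_char (s * \<tau> i) - w i) \<le> \<bar>s * \<tau> i\<bar> ^ 3"
      unfolding w_def by (rule norm_exp_char_minus_gaussian)
    also have "\<dots> = \<bar>\<tau> i\<bar> * (\<bar>s\<bar> ^ 3 * \<bar>\<tau> i\<bar>\<^sup>2)"
      by (simp only: power_mult_distrib abs_mult) (simp only: power3_eq_cube power2_eq_square mult_ac)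
    also have "\<dots> \<le> \<delta> * (\<bar>s\<bar> ^ 3 * \<bar>\<tau> i\<bar>\<^sup>2)"
      by (rule mult_right_mono[OF assms(3)[OF i]]) auto
    finally show "norm (exp_char (s * \<tau> i) - w i) \<le> \<delta> * \<bar>s\<bar> ^ 3 * (\<tau> i)\<^sup>2" by simp
  qed
  also have "\<dots> = \<delta> * \<bar>s\<bar> ^ 3" using assms(2) by (simp add: sum_distrib_left [symmetric])
  finally show ?thesis unfolding w .
qed

section \<open>The Gaussian integral and the error functional\<close>

lemma integrable_exp_neg_half_square: "integrable lborel (\<lambda>s::real. exp (- (s\<^sup>2 / 2)))"
proof -
  have "integrable lborel (\<lambda>s. sqrt (2 * pi) * std_normal_density s)"
    by (intro integrable_mult_right) simp
  thus ?thesis by (simp add: std_normal_density_def)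
qed

text \<open>Up to the constant sqrt (2 pi), the integrand is the standard normal density times a
  phase, so the known characteristic function of that law, read at \<open>\<mu>\<close>, evaluates
  the integral.\<close>

lemma
  fixes \<mu> :: real
  defines "g \<equiv> (\<lambda>s::real. exp (\<i> * complex_of_real (s * \<mu>) - complex_of_real (s\<^sup>2 / 2)))"
  shows integrable_gaussian_char: "integrable lborel g"
    and integral_gaussian_char: "integral\<^sup>L lborel g = complex_of_real (sqrt (2 * pi) * exp (- (\<mu>\<^sup>2 / 2)))"
proof -
  have meas: "g \<in> borel_measurable borel"
    unfolding g_def by (intro borel_measurable_continuous_onI continuous_intros) auto
  show "integrable lborel g"
    by (rule Bochner_Integration.integrable_bound[OF integrable_exp_neg_half_square])
       (use meas in \<open>auto simp: g_def\<close>)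
  have "complex_of_real (exp (- (\<mu>\<^sup>2 / 2))) = char std_normal_distribution \<mu>"
    by (simp add: char_std_normal_distribution)
  also have "\<dots> = (LINT s|lborel. std_normal_density s *\<^sub>R iexp (\<mu> * s))"
    unfolding char_def by (subst integral_density) auto
  also have "\<dots> = (LINT s|lborel. complex_of_real (1 / sqrt (2 * pi)) * g s)"
  proof (rule Bochner_Integration.integral_cong)
    fix s
    have "g s = complex_of_real (exp (- (s\<^sup>2 / 2))) * iexp (\<mu> * s)"
      unfolding g_def exp_of_real [symmetric] exp_add [symmetric] by (simp add: mult.commute)
    thus "std_normal_density s *\<^sub>R iexp (\<mu> * s) = complex_of_real (1 / sqrt (2 * pi)) * g s"
      by (simp only: std_normal_density_def scaleR_conv_of_real of_real_mult mult.assoc minus_divide_left [symmetric])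
  qed simp
  also have "\<dots> = complex_of_real (1 / sqrt (2 * pi)) * integral\<^sup>L lborel g" by simp
  finally show "integral\<^sup>L lborel g = complex_of_real (sqrt (2 * pi) * exp (- (\<mu>\<^sup>2 / 2)))"
    by simp
qed

text \<open>The minimum combines the cubic bound, good for small frequencies, with the integrable
  tail bound. The result depends on \<open>\<delta>\<close> alone, so it serves all index sets and
  means at once.\<close>

definition gaussian_error :: "real \<Rightarrow> real" where
  "gaussian_error \<delta> = (LINT s|lborel. min (\<delta> * \<bar>s\<bar> ^ 3) (1 / (1 + 1 / 2 * s\<^sup>2) + exp (- (s\<^sup>2 / 2))))"

lemma integrable_gaussian_error_bound:
  "integrable lborel (\<lambda>s::real. 1 / (1 + 1 / 2 * s\<^sup>2) + exp (- (s\<^sup>2 / 2)))"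
  by (intro Bochner_Integration.integrable_add integrable_exp_neg_half_square integrable_inverse_1_plus_mult_square) simp

lemma integrable_gaussian_error:
  assumes "\<delta> \<ge> 0"
  shows "integrable lborel (\<lambda>s::real. min (\<delta> * \<bar>s\<bar> ^ 3) (1 / (1 + 1 / 2 * s\<^sup>2) + exp (- (s\<^sup>2 / 2))))"
  by (rule Bochner_Integration.integrable_bound[OF integrable_gaussian_error_bound])
     (use assms in \<open>auto intro!: always_eventually simp: abs_of_nonneg\<close>)

lemma gaussian_error_tendsto_0:
  assumes "\<And>n. \<delta> n \<ge> 0" "\<delta> \<longlonglongrightarrow> 0"
  shows "(\<lambda>n. gaussian_error (\<delta> n)) \<longlonglongrightarrow> 0"
proof -
  have "(\<lambda>n. gaussian_error (\<delta> n)) \<longlonglongrightarrow> (LINT s|(lborel::real measure). 0)"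
    unfolding gaussian_error_def
  proof (rule integral_dominated_convergence[OF _ _ integrable_gaussian_error_bound])
    show "AE s in lborel. (\<lambda>n. min (\<delta> n * \<bar>s\<bar> ^ 3) (1 / (1 + 1 / 2 * s\<^sup>2) + exp (- (s\<^sup>2 / 2)))) \<longlonglongrightarrow> 0"
    proof (intro always_eventually allI)
      fix s :: real
      have "(\<lambda>n. min (\<delta> n * \<bar>s\<bar> ^ 3) (1 / (1 + 1 / 2 * s\<^sup>2) + exp (- (s\<^sup>2 / 2)))) \<longlonglongrightarrow>
         min (0 * \<bar>s\<bar> ^ 3) (1 / (1 + 1 / 2 * s\<^sup>2) + exp (- (s\<^sup>2 / 2)))"
        by (intro tendsto_intros assms)
      thus "(\<lambda>n. min (\<delta> n * \<bar>s\<bar> ^ 3) (1 / (1 + 1 / 2 * s\<^sup>2) + exp (- (s\<^sup>2 / 2)))) \<longlonglongrightarrow> 0"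
        by (simp add: min_def split: if_splits)
    qed
  qed (use assms in \<open>auto intro!: always_eventually simp: abs_of_nonneg\<close>)
  thus ?thesis by simp
qed

text \<open>Only the variance is normalised. The mean enters through a phase of modulus one, so the
  error is uniform in it.\<close>

lemma integral_exp_char_prod_standardized:
  assumes "finite I" "(\<Sum>i\<in>I. (\<tau> i)\<^sup>2) = 1" "\<And>i. i \<in> I \<Longrightarrow> \<bar>\<tau> i\<bar> \<le> \<delta>" "\<delta>\<^sup>2 \<le> 1 / 2" "\<delta> \<ge> 0"
  shows "norm ((LINT s|lborel. exp_char_prod \<tau> I s) - complex_of_real (sqrt (2 * pi) * exp (- ((\<Sum>i\<in>I. \<tau> i)\<^sup>2 / 2))))
           \<le> gaussian_error \<delta>"
proof -
  define g where "g = (\<lambda>s::real. exp (\<i> * complex_of_real (s * (\<Sum>i\<in>I. \<tau> i)) - complex_of_real (s\<^sup>2 / 2)))"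
  have sq: "(\<tau> i)\<^sup>2 \<le> 1 / 2" if "i \<in> I" for i
    using power_mono[OF assms(3)[OF that], of 2] assms(4) by simp
  note dom = norm_exp_char_prod_standardized_le[OF assms(1,2) sq]
  have int: "integrable lborel (exp_char_prod \<tau> I)"
    by (rule Bochner_Integration.integrable_bound[OF integrable_inverse_1_plus_mult_square[of "1/2"]])
       (auto intro!: always_eventually order.trans[OF dom])
  have diff: "integrable lborel (\<lambda>s. exp_char_prod \<tau> I s - g s)"
    unfolding g_def by (intro Bochner_Integration.integrable_diff int integrable_gaussian_char)
  have "(LINT s|lborel. norm (exp_char_prod \<tau> I s - g s)) \<le> gaussian_error \<delta>"
    unfolding gaussian_error_def
  proof (rule Bochner_Integration.integral_mono)
    fix s
    have "norm (exp_char_prod \<tau> I s - g s) \<le> norm (exp_char_prod \<tau> I s) + norm (g s)"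
      by (rule norm_triangle_ineq4)
    also have "\<dots> \<le> 1 / (1 + 1 / 2 * s\<^sup>2) + exp (- (s\<^sup>2 / 2))"
      by (rule add_mono[OF dom]) (auto simp: g_def)
    finally show "norm (exp_char_prod \<tau> I s - g s) \<le> min (\<delta> * \<bar>s\<bar> ^ 3) (1 / (1 + 1 / 2 * s\<^sup>2) + exp (- (s\<^sup>2 / 2)))"
      using norm_exp_char_prod_minus_gaussian[OF assms(1-3), of s] by (simp add: g_def)
  qed (rule integrable_norm[OF diff] integrable_gaussian_error[OF assms(5)])+
  hence "norm (LINT s|lborel. exp_char_prod \<tau> I s - g s) \<le> gaussian_error \<delta>"
    by (rule order.trans[OF integral_norm_bound])
  thus ?thesis
    unfolding g_def
    by (simp only: Bochner_Integration.integral_diff[OF int integrable_gaussian_char] integral_gaussian_char)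
qed

lemma integral_exp_char_prod_approx:
  assumes "finite I" "V = (\<Sum>i\<in>I. (\<tau> i)\<^sup>2)" "V > 0" "\<And>i. i \<in> I \<Longrightarrow> \<bar>\<tau> i\<bar> \<le> \<delta> * sqrt V" "\<delta>\<^sup>2 \<le> 1 / 2" "\<delta> \<ge> 0"
  shows "norm (complex_of_real (sqrt V) * (LINT s|lborel. exp_char_prod \<tau> I s)
           - complex_of_real (sqrt (2 * pi) * exp (- ((\<Sum>i\<in>I. \<tau> i)\<^sup>2 / (2 * V))))) \<le> gaussian_error \<delta>"
proof -
  have "exp_char_prod \<tau> I (0 + 1 / sqrt V * s) = exp_char_prod (\<lambda>i. \<tau> i / sqrt V) I s" for s
    by (simp add: exp_char_prod_def mult.commute)
  hence "(LINT s|lborel. exp_char_prod \<tau> I s) = \<bar>1 / sqrt V\<bar> *\<^sub>R (LINT s|lborel. exp_char_prod (\<lambda>i. \<tau> i / sqrt V) I s)"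
    using lborel_integral_real_affine[of "1 / sqrt V" "exp_char_prod \<tau> I" 0] assms by simp
  hence "complex_of_real (sqrt V) * (LINT s|lborel. exp_char_prod \<tau> I s) = (LINT s|lborel. exp_char_prod (\<lambda>i. \<tau> i / sqrt V) I s)"
    using assms(3) by (simp add: scaleR_conv_of_real)
  moreover have "(\<Sum>i\<in>I. \<tau> i)\<^sup>2 / (2 * V) = (\<Sum>i\<in>I. \<tau> i / sqrt V)\<^sup>2 / 2"
    using assms(3) by (simp add: sum_divide_distrib [symmetric] power_divide)
  moreover have "norm ((LINT s|lborel. exp_char_prod (\<lambda>i. \<tau> i / sqrt V) I s)
      - complex_of_real (sqrt (2 * pi) * exp (- ((\<Sum>i\<in>I. \<tau> i / sqrt V)\<^sup>2 / 2)))) \<le> gaussian_error \<delta>"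
    using assms
    by (intro integral_exp_char_prod_standardized)
       (auto simp: power_divide sum_divide_distrib [symmetric] abs_divide pos_divide_le_eq)
  ultimately show ?thesis by (simp only:)
qed

section \<open>Sums of negative powers\<close>

text \<open>The difference quotient is the integral of x^(-p) over [k, k+1]; the mean value theorem
  expresses it as z^(-p) with z strictly between the ends.\<close>

lemma powr_neg_telescope_bounds:
  fixes p :: real and k :: nat
  assumes "p > 1" "k \<ge> 1"
  shows "real (Suc k) powr - p \<le> (real k powr (1 - p) - real (Suc k) powr (1 - p)) / (p - 1)"
    and "(real k powr (1 - p) - real (Suc k) powr (1 - p)) / (p - 1) \<le> real k powr - p"
proof -
  have "\<exists>z. real k < z \<and> z < real (Suc k) \<and>
     real (Suc k) powr (1 - p) / (1 - p) - real k powr (1 - p) / (1 - p) = (real (Suc k) - real k) * z powr - p"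
  proof (rule MVT2)
    fix x assume "real k \<le> x" "x \<le> real (Suc k)"
    hence "x > 0" using assms by simp
    from DERIV_cdivide[OF has_real_derivative_powr[OF this, of "1 - p"], of "1 - p"]
    show "((\<lambda>x. x powr (1 - p) / (1 - p)) has_real_derivative x powr - p) (at x)"
      using assms by simp
  qed simp
  then obtain z where z: "real k < z" "z < real (Suc k)"
    "real (Suc k) powr (1 - p) / (1 - p) - real k powr (1 - p) / (1 - p) = z powr - p"
    by auto
  have eq: "(real k powr (1 - p) - real (Suc k) powr (1 - p)) / (p - 1) = z powr - p"
  proof -
    have "(u - v) / (p - 1) = v / (1 - p) - u / (1 - p)" for u v :: real
      unfolding diff_divide_distrib [symmetric] by (metis minus_diff_eq minus_divide_divide)
    thus ?thesis using z(3) by (simp only:)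
  qed
  show "real (Suc k) powr - p \<le> (real k powr (1 - p) - real (Suc k) powr (1 - p)) / (p - 1)"
    and "(real k powr (1 - p) - real (Suc k) powr (1 - p)) / (p - 1) \<le> real k powr - p"
    unfolding eq using z assms by (auto intro!: powr_mono2')
qed

lemma sum_powr_neg_bounds:
  fixes p :: real and a c :: nat
  assumes "p > 1" "a \<ge> 1" "a \<le> c"
  shows "(real a powr (1 - p) - real (Suc c) powr (1 - p)) / (p - 1) \<le> (\<Sum>k=a..c. real k powr - p)"
    and "(\<Sum>k=a..c. real k powr - p) \<le> real a powr - p + (real a powr (1 - p) - real c powr (1 - p)) / (p - 1)"
proof -
  have "(real a powr (1 - p) - real (Suc c) powr (1 - p)) / (p - 1) \<le> (\<Sum>k=a..c. real k powr - p) \<and>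
    (\<Sum>k=a..c. real k powr - p) \<le> real a powr - p + (real a powr (1 - p) - real c powr (1 - p)) / (p - 1)"
    using assms(3)
  proof (induction c rule: dec_induct)
    case base
    show ?case using powr_neg_telescope_bounds[OF assms(1,2)] by simp
  next
    case (step n)
    have n: "n \<ge> 1" using step assms by simp
    show ?case
      using step powr_neg_telescope_bounds(1)[OF assms(1) n] powr_neg_telescope_bounds(2)[OF assms(1), of "Suc n"]
      by (simp add: diff_divide_distrib)
  qed
  thus "(real a powr (1 - p) - real (Suc c) powr (1 - p)) / (p - 1) \<le> (\<Sum>k=a..c. real k powr - p)"
    and "(\<Sum>k=a..c. real k powr - p) \<le> real a powr - p + (real a powr (1 - p) - real c powr (1 - p)) / (p - 1)"
    by auto
qed

lemma tendsto_ratio_Suc: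
  assumes "filterlim X at_top sequentially" "(\<lambda>n. real (x n) / X n) \<longlonglongrightarrow> l"
  shows "(\<lambda>n. real (Suc (x n)) / X n) \<longlonglongrightarrow> l"
proof -
  have "(\<lambda>n. real (x n) / X n + inverse (X n)) \<longlonglongrightarrow> l + 0"
    by (intro tendsto_intros assms tendsto_inverse_0_at_top assms(1))
  thus ?thesis by (simp add: add_divide_distrib inverse_eq_divide add.commute)
qed

lemma tendsto_ratio_powr:
  assumes "filterlim X at_top sequentially" "(\<lambda>n. real (x n) / X n) \<longlonglongrightarrow> 1"
  shows "(\<lambda>n. X n powr - q * real (x n) powr q) \<longlonglongrightarrow> 1"
proof -
  have "(\<lambda>n. (real (x n) / X n) powr q) \<longlonglongrightarrow> 1 powr q"
    by (intro tendsto_intros assms) auto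
  moreover have "\<forall>\<^sub>F n in sequentially. (real (x n) / X n) powr q = X n powr - q * real (x n) powr q"
    using filterlim_at_top_dense[THEN iffD1, OF assms(1), rule_format, of 0]
    by eventually_elim (simp add: powr_divide powr_minus field_simps)
  ultimately show ?thesis by (simp add: tendsto_cong)
qed

text \<open>The sum is squeezed between telescoped integrals. The single term x^(-p) in the upper
  bound is smaller by a factor of order 1/A, and the shift from y to y + 1 does not change the
  limit. The value \<open>\<rho>\<close> = 0 is allowed. The variance uses p = 2\<alpha>.\<close>

lemma sum_powr_neg_asymp:
  fixes A B :: "nat \<Rightarrow> real" and x y :: "nat \<Rightarrow> nat"
  assumes p: "p > 1"
    and A: "filterlim A at_top sequentially" and B: "filterlim B at_top sequentially"
    and x: "(\<lambda>n. real (x n) / A n) \<longlonglongrightarrow> 1" and y: "(\<lambda>n. real (y n) / B n) \<longlonglongrightarrow> 1"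
    and xy: "\<forall>\<^sub>F n in sequentially. x n \<ge> 1 \<and> x n \<le> y n"
    and \<rho>: "(\<lambda>n. (A n / B n) powr (p - 1)) \<longlonglongrightarrow> \<rho>"
  shows "(\<lambda>n. A n powr (p - 1) * (\<Sum>k=x n..y n. real k powr - p)) \<longlonglongrightarrow> (1 - \<rho>) / (p - 1)"
proof (rule tendsto_sandwich)
  have pos: "\<forall>\<^sub>F n in sequentially. A n > 0 \<and> B n > 0"
    using filterlim_at_top_dense[THEN iffD1, OF A, rule_format, of 0]
      filterlim_at_top_dense[THEN iffD1, OF B, rule_format, of 0]
    by eventually_elim auto
  have lim_y: "(\<lambda>n. A n powr (p - 1) * real (z n) powr (1 - p)) \<longlonglongrightarrow> \<rho>"
    if z: "(\<lambda>n. real (z n) / B n) \<longlonglongrightarrow> 1" for z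
  proof -
    have "(\<lambda>n. (A n / B n) powr (p - 1) * (B n powr - (1 - p) * real (z n) powr (1 - p))) \<longlonglongrightarrow> \<rho> * 1"
      by (intro tendsto_mult \<rho> tendsto_ratio_powr B z)
    moreover have "\<forall>\<^sub>F n in sequentially. (A n / B n) powr (p - 1) * (B n powr - (1 - p) * real (z n) powr (1 - p))
         = A n powr (p - 1) * real (z n) powr (1 - p)"
      using pos by eventually_elim (simp add: powr_divide)
    ultimately show ?thesis by (simp only: tendsto_cong mult_1_right)
  qed
  have lim_x: "(\<lambda>n. A n powr (p - 1) * real (x n) powr (1 - p)) \<longlonglongrightarrow> 1"
    using tendsto_ratio_powr[OF A x, of "1 - p"] by simp
  have lim_x': "(\<lambda>n. A n powr (p - 1) * real (x n) powr - p) \<longlonglongrightarrow> 0"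
  proof -
    have "(\<lambda>n. A n powr - (- p) * real (x n) powr - p * inverse (A n)) \<longlonglongrightarrow> 1 * 0"
      by (intro tendsto_mult tendsto_ratio_powr A x tendsto_inverse_0_at_top A)
    moreover have "\<forall>\<^sub>F n in sequentially. A n powr - (- p) * real (x n) powr - p * inverse (A n)
         = A n powr (p - 1) * real (x n) powr - p"
      using pos by eventually_elim (simp add: powr_diff field_simps)
    ultimately show ?thesis by (simp only: tendsto_cong mult_zero_right)
  qed
  let ?S = "\<lambda>n. \<Sum>k=x n..y n. real k powr - p"
  show "\<forall>\<^sub>F n in sequentially. (A n powr (p - 1) * real (x n) powr (1 - p) - A n powr (p - 1) * real (Suc (y n)) powr (1 - p)) / (p - 1)
      \<le> A n powr (p - 1) * ?S n"
    using xy
  proof eventually_elim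
    case (elim n)
    have "A n powr (p - 1) * ((real (x n) powr (1 - p) - real (Suc (y n)) powr (1 - p)) / (p - 1)) \<le> A n powr (p - 1) * ?S n"
      by (intro mult_left_mono sum_powr_neg_bounds p) (use elim in auto)
    thus ?case by (simp add: right_diff_distrib)
  qed
  show "\<forall>\<^sub>F n in sequentially. A n powr (p - 1) * ?S n \<le> A n powr (p - 1) * real (x n) powr - p +
     (A n powr (p - 1) * real (x n) powr (1 - p) - A n powr (p - 1) * real (y n) powr (1 - p)) / (p - 1)"
    using xy
  proof eventually_elim
    case (elim n)
    have "A n powr (p - 1) * ?S n \<le> A n powr (p - 1) * (real (x n) powr - p + (real (x n) powr (1 - p) - real (y n) powr (1 - p)) / (p - 1))"
      by (intro mult_left_mono sum_powr_neg_bounds p) (use elim in auto)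
    thus ?case by (simp add: right_diff_distrib distrib_left)
  qed
  show "(\<lambda>n. (A n powr (p - 1) * real (x n) powr (1 - p) - A n powr (p - 1) * real (Suc (y n)) powr (1 - p)) / (p - 1))
      \<longlonglongrightarrow> (1 - \<rho>) / (p - 1)"
    by (intro tendsto_intros lim_x lim_y tendsto_ratio_Suc B y) (use p in auto)
  have "(\<lambda>n. A n powr (p - 1) * real (x n) powr - p +
     (A n powr (p - 1) * real (x n) powr (1 - p) - A n powr (p - 1) * real (y n) powr (1 - p)) / (p - 1))
     \<longlonglongrightarrow> 0 + (1 - \<rho>) / (p - 1)"
    by (intro tendsto_intros lim_x lim_x' lim_y y) (use p in auto)
  thus "(\<lambda>n. A n powr (p - 1) * real (x n) powr - p +
     (A n powr (p - 1) * real (x n) powr (1 - p) - A n powr (p - 1) * real (y n) powr (1 - p)) / (p - 1))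
     \<longlonglongrightarrow> (1 - \<rho>) / (p - 1)" by simp
qed

text \<open>Only the terms between \<open>x\<close> and \<open>y\<close> survive in the difference,
  and by monotonicity each lies between the two endpoint values. Writing prefix sums permits either
  order of \<open>x\<close> and \<open>y\<close>.\<close>

lemma sum_powr_neg_diff_bound:
  fixes \<alpha> t :: real and x y :: nat
  assumes "\<alpha> > 0" "x \<ge> 1" "y \<ge> 1"
  shows "\<bar>(\<Sum>k<x. real k powr - \<alpha>) - (\<Sum>k<y. real k powr - \<alpha>) - (real x - real y) * t\<bar>
     \<le> \<bar>real x - real y\<bar> * (\<bar>real x powr - \<alpha> - t\<bar> + \<bar>real y powr - \<alpha> - t\<bar>)"
proof -
  have *: "\<bar>(\<Sum>k<v. real k powr - \<alpha>) - (\<Sum>k<u. real k powr - \<alpha>) - (real v - real u) * t\<bar>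
     \<le> (real v - real u) * (\<bar>real u powr - \<alpha> - t\<bar> + \<bar>real v powr - \<alpha> - t\<bar>)"
    if "u \<le> v" "u \<ge> 1" for u v :: nat
  proof -
    have "(\<Sum>k<v. real k powr - \<alpha>) - (\<Sum>k<u. real k powr - \<alpha>) = (\<Sum>k\<in>{u..<v}. real k powr - \<alpha>)"
      using sum.atLeastLessThan_concat[of 0 u v "\<lambda>k. real k powr - \<alpha>"] that by (simp add: atLeast0LessThan)
    hence "(\<Sum>k<v. real k powr - \<alpha>) - (\<Sum>k<u. real k powr - \<alpha>) - (real v - real u) * t = (\<Sum>k\<in>{u..<v}. real k powr - \<alpha> - t)"
      using that by (simp add: sum_subtractf of_nat_diff)
    also have "\<bar>\<dots>\<bar> \<le> (\<Sum>k\<in>{u..<v}. \<bar>real u powr - \<alpha> - t\<bar> + \<bar>real v powr - \<alpha> - t\<bar>)"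
    proof (rule order.trans[OF sum_abs sum_mono])
      fix k assume k: "k \<in> {u..<v}"
      have "real k powr - \<alpha> \<le> real u powr - \<alpha>" "real v powr - \<alpha> \<le> real k powr - \<alpha>"
        using k that assms by (auto intro!: powr_mono2')
      thus "\<bar>real k powr - \<alpha> - t\<bar> \<le> \<bar>real u powr - \<alpha> - t\<bar> + \<bar>real v powr - \<alpha> - t\<bar>" by linarith
    qed
    finally show ?thesis using that by (simp add: of_nat_diff)
  qed
  show ?thesis
  proof (cases "y \<le> x")
    case True
    thus ?thesis using *[of y x] assms by (simp add: add.commute)
  next
    case False
    hence "\<bar>- ((\<Sum>k<y. real k powr - \<alpha>) - (\<Sum>k<x. real k powr - \<alpha>) - (real y - real x) * t)\<bar>
     \<le> (real y - real x) * (\<bar>real x powr - \<alpha> - t\<bar> + \<bar>real y powr - \<alpha> - t\<bar>)"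
      unfolding abs_minus_cancel using *[of x y] assms by simp
    moreover have "- ((\<Sum>k<y. real k powr - \<alpha>) - (\<Sum>k<x. real k powr - \<alpha>) - (real y - real x) * t)
       = (\<Sum>k<x. real k powr - \<alpha>) - (\<Sum>k<y. real k powr - \<alpha>) - (real x - real y) * t"
      by (simp add: algebra_simps)
    ultimately show ?thesis using False by simp
  qed
qed

text \<open>There are O(sqrt X) terms, each differing from X^(-\<alpha>) by o(X^(-\<alpha>)), so
  replacing them all costs o(X^(1/2-\<alpha>)).\<close>

lemma sum_powr_neg_diff_asymp:
  fixes X :: "nat \<Rightarrow> real" and x y :: "nat \<Rightarrow> nat"
  assumes \<alpha>: "\<alpha> > 0" and X: "filterlim X at_top sequentially"
    and x: "(\<lambda>n. real (x n) / X n) \<longlonglongrightarrow> 1" and y: "(\<lambda>n. real (y n) / X n) \<longlonglongrightarrow> 1"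
    and x1: "\<And>n. x n \<ge> 1" and y1: "\<And>n. y n \<ge> 1"
    and xy: "\<And>n. \<bar>real (x n) - real (y n)\<bar> \<le> K * sqrt (X n)"
  shows "(\<lambda>n. X n powr (\<alpha> - 1/2) * ((\<Sum>k<x n. real k powr - \<alpha>) - (\<Sum>k<y n. real k powr - \<alpha>)
            - (real (x n) - real (y n)) * X n powr - \<alpha>)) \<longlonglongrightarrow> 0"
proof (rule Lim_null_comparison)
  have pos: "\<forall>\<^sub>F n in sequentially. X n > 0"
    using filterlim_at_top_dense[THEN iffD1, OF X] by blast
  show "\<forall>\<^sub>F n in sequentially. norm (X n powr (\<alpha> - 1/2) * ((\<Sum>k<x n. real k powr - \<alpha>) - (\<Sum>k<y n. real k powr - \<alpha>)
            - (real (x n) - real (y n)) * X n powr - \<alpha>))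
      \<le> K * (\<bar>X n powr - (- \<alpha>) * real (x n) powr - \<alpha> - 1\<bar> + \<bar>X n powr - (- \<alpha>) * real (y n) powr - \<alpha> - 1\<bar>)"
    using pos
  proof eventually_elim
    case (elim n)
    let ?e = "\<bar>real (x n) powr - \<alpha> - X n powr - \<alpha>\<bar> + \<bar>real (y n) powr - \<alpha> - X n powr - \<alpha>\<bar>"
    have e: "X n powr \<alpha> * \<bar>u - X n powr - \<alpha>\<bar> = \<bar>X n powr \<alpha> * u - 1\<bar>" for u
    proof -
      have "X n powr \<alpha> * u - 1 = X n powr \<alpha> * (u - X n powr - \<alpha>)"
        using elim by (simp add: right_diff_distrib powr_minus)
      thus ?thesis using elim by (simp add: abs_mult)
    qed
    have "\<bar>(\<Sum>k<x n. real k powr - \<alpha>) - (\<Sum>k<y n. real k powr - \<alpha>) - (real (x n) - real (y n)) * X n powr - \<alpha>\<bar>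
      \<le> \<bar>real (x n) - real (y n)\<bar> * ?e"
      by (rule sum_powr_neg_diff_bound[OF \<alpha> x1 y1])
    also have "\<dots> \<le> K * sqrt (X n) * ?e"
      by (intro mult_right_mono xy) auto
    finally have "X n powr (\<alpha> - 1/2) * \<bar>(\<Sum>k<x n. real k powr - \<alpha>) - (\<Sum>k<y n. real k powr - \<alpha>) - (real (x n) - real (y n)) * X n powr - \<alpha>\<bar>
       \<le> X n powr (\<alpha> - 1/2) * (K * sqrt (X n) * ?e)"
      by (intro mult_left_mono) auto
    also have "\<dots> = K * ((X n powr (\<alpha> - 1/2) * sqrt (X n)) * ?e)" by (simp only: mult_ac)
    also have "X n powr (\<alpha> - 1/2) * sqrt (X n) = X n powr \<alpha>"
      using elim by (simp add: powr_half_sqrt [symmetric] powr_add [symmetric])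
    finally show ?case by (simp add: abs_mult distrib_left e)
  qed
  have "(\<lambda>n. K * (\<bar>X n powr - (- \<alpha>) * real (x n) powr - \<alpha> - 1\<bar> + \<bar>X n powr - (- \<alpha>) * real (y n) powr - \<alpha> - 1\<bar>))
     \<longlonglongrightarrow> K * (\<bar>1 - 1\<bar> + \<bar>1 - 1\<bar>)"
    by (intro tendsto_intros tendsto_ratio_powr X x y)
  thus "(\<lambda>n. K * (\<bar>X n powr - (- \<alpha>) * real (x n) powr - \<alpha> - 1\<bar> + \<bar>X n powr - (- \<alpha>) * real (y n) powr - \<alpha> - 1\<bar>)) \<longlonglongrightarrow> 0"
    by simp
qed

lemma tendsto_ratio_sqrt_perturbation:
  assumes X: "filterlim X at_top sequentially" and "\<And>n. \<bar>Y n\<bar> \<le> M * sqrt (X n)"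
    and "\<And>n. real (x n) = X n + Y n"
  shows "(\<lambda>n. real (x n) / X n) \<longlonglongrightarrow> 1"
proof -
  have pos: "\<forall>\<^sub>F n in sequentially. X n > 0"
    using filterlim_at_top_dense[THEN iffD1, OF X] by blast
  have "(\<lambda>n. Y n / X n) \<longlonglongrightarrow> 0"
  proof (rule Lim_null_comparison)
    show "\<forall>\<^sub>F n in sequentially. norm (Y n / X n) \<le> M * inverse (sqrt (X n))"
      using pos
    proof eventually_elim
      case (elim n)
      have "\<bar>Y n\<bar> / X n \<le> M * sqrt (X n) / X n" using assms(2)[of n] elim by (intro divide_right_mono) auto
      also have "\<dots> = M * inverse (sqrt (X n))" using elim by (simp add: field_simps)
      finally show ?case using elim by simp
    qed
    show "(\<lambda>n. M * inverse (sqrt (X n))) \<longlonglongrightarrow> 0"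
      by (intro tendsto_mult_right_zero tendsto_inverse_0_at_top filterlim_compose[OF sqrt_at_top X])
  qed
  hence "(\<lambda>n. 1 + Y n / X n) \<longlonglongrightarrow> 1 + 0" by (intro tendsto_intros)
  moreover have "\<forall>\<^sub>F n in sequentially. 1 + Y n / X n = real (x n) / X n"
    using pos by eventually_elim (simp add: assms(3) field_simps)
  ultimately show ?thesis by (simp add: tendsto_cong)
qed

section \<open>Asymptotics along a sequence of endpoints\<close>

text \<open>Times -2, this is the scaled mean of the waiting-time difference in the limit.\<close>

definition bingo_deviation :: "real \<Rightarrow> real \<Rightarrow> real \<Rightarrow> real \<Rightarrow> real \<Rightarrow> real" where
  "bingo_deviation \<alpha> A B \<Lambda> \<Gamma> = \<Lambda> / A powr (1/2) - \<Gamma> / (B powr \<alpha> * A powr (1/2 - \<alpha>))"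

definition bingo_main :: "real \<Rightarrow> real \<Rightarrow> real \<Rightarrow> real \<Rightarrow> real \<Rightarrow> real" where
  "bingo_main \<alpha> A B \<Lambda> \<Gamma> = sqrt ((2 * \<alpha> - 1) / pi) * A powr (\<alpha> - 1/2)
     / (B powr \<alpha> * sqrt (1 - (A / B) powr (2 * \<alpha> - 1)))
     * exp (- (2 * \<alpha> - 1) / (1 - (A / B) powr (2 * \<alpha> - 1)) * (bingo_deviation \<alpha> A B \<Lambda> \<Gamma>)\<^sup>2)"

lemma sqrt_powr_double_minus_1: "sqrt (x powr (2 * q - 1)) = x powr (q - 1/2)"
proof -
  have "sqrt (x powr (2 * q - 1)) = x powr ((2 * q - 1) * (1/2))"
    by (simp only: powr_powr [symmetric] powr_half_sqrt powr_ge_zero)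
  also have "(2 * q - 1) * (1/2) = q - 1/2" by (simp add: field_simps)
  finally show ?thesis .
qed

lemma powr_minus_half: "x > 0 \<Longrightarrow> x powr q * inverse (sqrt x) = x powr (q - 1/2)"
  by (simp only: powr_diff) (simp add: powr_half_sqrt inverse_eq_divide)

text \<open>Since B is at least A, sqrt B is at most B^\<alpha> A^(1/2-\<alpha>), so each of the two
  terms is at most M. The bound supplies compactness and keeps the exponential in the main term away
  from 0.\<close>

lemma bingo_deviation_bound:
  assumes "\<alpha> > 1" "M > 0" "A > 0" "B \<ge> A" "\<bar>\<Lambda>\<bar> \<le> M * sqrt A" "\<bar>\<Gamma>\<bar> \<le> M * sqrt B"
  shows "\<bar>bingo_deviation \<alpha> A B \<Lambda> \<Gamma>\<bar> \<le> 2 * M"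
proof -
  have 1: "\<bar>\<Lambda> / A powr (1/2)\<bar> \<le> M"
    using assms by (simp add: powr_half_sqrt abs_divide pos_divide_le_eq)
  have "A powr (\<alpha> - 1/2) \<le> B powr (\<alpha> - 1/2)" using assms by (intro powr_mono2) auto
  hence "sqrt B * A powr (\<alpha> - 1/2) * A powr (1/2 - \<alpha>) \<le> sqrt B * B powr (\<alpha> - 1/2) * A powr (1/2 - \<alpha>)"
    using assms by (intro mult_right_mono mult_left_mono) auto
  also have "sqrt B * B powr (\<alpha> - 1/2) = B powr \<alpha>"
    using assms by (simp add: powr_half_sqrt [symmetric] powr_add [symmetric])
  also have "sqrt B * A powr (\<alpha> - 1/2) * A powr (1/2 - \<alpha>) = sqrt B"
    using assms by (simp add: mult.assoc powr_add [symmetric])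
  finally have "M * sqrt B \<le> M * (B powr \<alpha> * A powr (1/2 - \<alpha>))"
    using assms by (intro mult_left_mono) auto
  hence "\<bar>\<Gamma>\<bar> \<le> M * (B powr \<alpha> * A powr (1/2 - \<alpha>))" using assms by linarith
  hence 2: "\<bar>\<Gamma> / (B powr \<alpha> * A powr (1/2 - \<alpha>))\<bar> \<le> M"
    using assms by (simp add: abs_divide abs_mult pos_divide_le_eq)
  from 1 2 show ?thesis unfolding bingo_deviation_def by linarith
qed

text \<open>This is how the separation by \<theta> keeps the denominators 1 - (A/B)^(2\<alpha>-1)
  uniformly away from 0.\<close>

lemma ratio_powr_le:
  assumes "\<theta> > 1" "A > 0" "B \<ge> \<theta> * A" "q > 0"
  shows "(A / B) powr q \<le> \<theta> powr - q" "\<theta> powr - q < (1::real)"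
proof -
  have "B > 0" using assms by (smt (verit) mult_pos_pos)
  hence "A / B \<le> 1 / \<theta>" using assms by (simp add: field_simps)
  hence "(A / B) powr q \<le> (1 / \<theta>) powr q" using assms \<open>B > 0\<close> by (intro powr_mono2) auto
  thus "(A / B) powr q \<le> \<theta> powr - q" using assms by (simp add: powr_divide powr_minus_divide)
  show "\<theta> powr - q < 1" using assms by (simp add: powr_less_one)
qed

text \<open>The limits \<open>\<rho>\<close> and \<open>D\<close> are those later extracted by
  compactness; \<open>\<rho>\<close> = 0 is the case B/A tending to infinity, with no limit of B/A
  itself assumed.\<close>

locale bingo_sequence =
  fixes \<alpha> M \<theta> :: real and a b c d :: "nat \<Rightarrow> nat" and A B \<Lambda> \<Gamma> :: "nat \<Rightarrow> real" and \<rho> D :: real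
  assumes \<alpha>: "\<alpha> > 1" and M: "M > 0" and \<theta>: "\<theta> > 1"
    and a: "\<And>n. real (a n) = A n + \<Lambda> n" and b: "\<And>n. real (b n) = A n - \<Lambda> n"
    and c: "\<And>n. real (c n) = B n + \<Gamma> n" and d: "\<And>n. real (d n) = B n - \<Gamma> n"
    and ge_1: "\<And>n. a n \<ge> 1" "\<And>n. b n \<ge> 1" "\<And>n. c n \<ge> 1" "\<And>n. d n \<ge> 1"
    and A_pos: "\<And>n. A n > 0" and B_ge: "\<And>n. B n \<ge> \<theta> * A n"
    and \<Lambda>: "\<And>n. \<bar>\<Lambda> n\<bar> \<le> M * sqrt (A n)" and \<Gamma>: "\<And>n. \<bar>\<Gamma> n\<bar> \<le> M * sqrt (B n)"
    and A_at_top: "filterlim A at_top sequentially"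
    and \<rho>_lim: "(\<lambda>n. (A n / B n) powr (2 * \<alpha> - 1)) \<longlonglongrightarrow> \<rho>"
    and D_lim: "(\<lambda>n. bingo_deviation \<alpha> (A n) (B n) (\<Lambda> n) (\<Gamma> n)) \<longlonglongrightarrow> D"
begin

lemma B_ge_A: "A n \<le> B n"
  using B_ge[of n] A_pos[of n] \<theta> by (smt (verit) mult_le_cancel_right1)

lemma B_pos: "B n > 0"
  using B_ge_A[of n] A_pos[of n] by linarith

lemma B_at_top: "filterlim B at_top sequentially"
  by (rule filterlim_at_top_mono[OF A_at_top]) (simp add: B_ge_A)

lemma ratio_lims:
  "(\<lambda>n. real (a n) / A n) \<longlonglongrightarrow> 1" "(\<lambda>n. real (b n) / A n) \<longlonglongrightarrow> 1"
  "(\<lambda>n. real (c n) / B n) \<longlonglongrightarrow> 1" "(\<lambda>n. real (d n) / B n) \<longlonglongrightarrow> 1"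
  subgoal by (rule tendsto_ratio_sqrt_perturbation[OF A_at_top \<Lambda> a])
  subgoal by (rule tendsto_ratio_sqrt_perturbation[OF A_at_top, where Y = "\<lambda>n. - \<Lambda> n" and M = M]) (simp_all add: \<Lambda> b)
  subgoal by (rule tendsto_ratio_sqrt_perturbation[OF B_at_top \<Gamma> c])
  subgoal by (rule tendsto_ratio_sqrt_perturbation[OF B_at_top, where Y = "\<lambda>n. - \<Gamma> n" and M = M]) (simp_all add: \<Gamma> d)
  done

lemma \<rho>_less_1: "\<rho> < 1"
proof -
  have "\<rho> \<le> \<theta> powr - (2 * \<alpha> - 1)"
    by (rule LIMSEQ_le_const2[OF \<rho>_lim]) (use ratio_powr_le(1)[OF \<theta> A_pos B_ge, of "2 * \<alpha> - 1"] \<alpha> in auto)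
  also have "\<dots> < 1" by (rule ratio_powr_le(2)[OF \<theta> A_pos B_ge]) (use \<alpha> in auto)
  finally show ?thesis .
qed

text \<open>The gap \<theta> is shared evenly: eventually x is at most sqrt \<theta> A and y at
  least B / sqrt \<theta>. This ensures that the target is reachable, so the nonzero branch of the
  integral formula applies.\<close>

lemma eventually_le: "\<forall>\<^sub>F n in sequentially. x n \<le> y n"
  if x: "(\<lambda>n. real (x n) / A n) \<longlonglongrightarrow> 1" and y: "(\<lambda>n. real (y n) / B n) \<longlonglongrightarrow> 1" for x y :: "nat \<Rightarrow> nat"
proof -
  have t: "sqrt \<theta> > 1" "inverse (sqrt \<theta>) < 1" using \<theta> by (auto simp: field_simps)
  show ?thesis
    using order_tendstoD(2)[OF x t(1)] order_tendstoD(1)[OF y t(2)]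
  proof eventually_elim
    case (elim n)
    have "real (x n) \<le> sqrt \<theta> * A n" using elim A_pos[of n] by (simp add: field_simps)
    also have "\<dots> = inverse (sqrt \<theta>) * (\<theta> * A n)" using \<theta> by (simp add: field_simps flip: power2_eq_square)
    also have "\<dots> \<le> inverse (sqrt \<theta>) * B n" using B_ge \<theta> by (intro mult_left_mono) auto
    also have "\<dots> \<le> real (y n)" using elim B_pos[of n] by (simp add: field_simps)
    finally show ?case by simp
  qed
qed

text \<open>\<open>V\<close> and \<open>\<mu>\<close> are the variance and mean of the waiting-time
  difference: an exponential variable of mean k^(-\<alpha>) has variance k^(-2\<alpha>), and
  variances add under subtraction.\<close>

definition V :: "nat \<Rightarrow> real" where
  "V n = (\<Sum>k=a n..c n. real k powr - (2 * \<alpha>)) + (\<Sum>k=b n..d n. real k powr - (2 * \<alpha>))"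

definition \<mu> :: "nat \<Rightarrow> real" where
  "\<mu> n = (\<Sum>k=a n..c n. real k powr - \<alpha>) - (\<Sum>k=b n..d n. real k powr - \<alpha>)"

lemma V_lim: "(\<lambda>n. A n powr (2 * \<alpha> - 1) * V n) \<longlonglongrightarrow> 2 * (1 - \<rho>) / (2 * \<alpha> - 1)"
proof -
  have "(\<lambda>n. A n powr (2 * \<alpha> - 1) * (\<Sum>k=a n..c n. real k powr - (2 * \<alpha>)) + A n powr (2 * \<alpha> - 1) * (\<Sum>k=b n..d n. real k powr - (2 * \<alpha>)))
     \<longlonglongrightarrow> (1 - \<rho>) / (2 * \<alpha> - 1) + (1 - \<rho>) / (2 * \<alpha> - 1)"
    using \<alpha> ge_1 eventually_le[OF ratio_lims(1) ratio_lims(3)] eventually_le[OF ratio_lims(2) ratio_lims(4)]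
    by (intro tendsto_add sum_powr_neg_asymp[OF _ A_at_top B_at_top] ratio_lims \<rho>_lim) auto
  thus ?thesis by (simp add: V_def distrib_left)
qed

text \<open>The bulk of the two sums cancels. What remains comes from the mismatch of the endpoints:
  about -2 \<Lambda> A^(-\<alpha>) at the start and +2 \<Gamma> B^(-\<alpha>) at the end.\<close>

lemma \<mu>_lim: "(\<lambda>n. A n powr (\<alpha> - 1/2) * \<mu> n) \<longlonglongrightarrow> - 2 * D"
proof -
  define \<Phi> where "\<Phi> x = (\<Sum>k<x. real k powr - \<alpha>)" for x :: nat
  define e1 where "e1 n = A n powr (\<alpha> - 1/2) * (\<Phi> (a n) - \<Phi> (b n) - (real (a n) - real (b n)) * A n powr - \<alpha>)" for n
  \<comment> \<open>The successors appear because levels c and d are included, while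
    \<open>\<Phi>\<close> sums strictly below its argument.\<close>
  define e2 where "e2 n = B n powr (\<alpha> - 1/2) * (\<Phi> (Suc (c n)) - \<Phi> (Suc (d n)) - (real (Suc (c n)) - real (Suc (d n))) * B n powr - \<alpha>)" for n
  have e1: "e1 \<longlonglongrightarrow> 0"
    unfolding e1_def \<Phi>_def
    by (rule sum_powr_neg_diff_asymp[OF _ A_at_top ratio_lims(1,2) ge_1(1,2), where K = "2 * M"])
       (use \<alpha> a b \<Lambda> in \<open>auto simp: abs_mult\<close>)
  have e2: "e2 \<longlonglongrightarrow> 0"
    unfolding e2_def \<Phi>_def
    by (rule sum_powr_neg_diff_asymp[OF _ B_at_top tendsto_ratio_Suc[OF B_at_top ratio_lims(3)]
          tendsto_ratio_Suc[OF B_at_top ratio_lims(4)], where K = "2 * M"])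
       (use \<alpha> c d \<Gamma> in \<open>auto simp: abs_mult\<close>)
  \<comment> \<open>The error \<open>e2\<close> is small on the scale of B; the square root, which
    equals (A/B)^(\<alpha>-1/2), converts it to the scale of A and stays bounded.\<close>
  have "(\<lambda>n. sqrt ((A n / B n) powr (2 * \<alpha> - 1)) * e2 n - e1 n - 2 * bingo_deviation \<alpha> (A n) (B n) (\<Lambda> n) (\<Gamma> n))
     \<longlonglongrightarrow> sqrt \<rho> * 0 - 0 - 2 * D"
    by (intro tendsto_intros e1 e2 \<rho>_lim D_lim)
  moreover have "\<forall>\<^sub>F n in sequentially. sqrt ((A n / B n) powr (2 * \<alpha> - 1)) * e2 n - e1 n - 2 * bingo_deviation \<alpha> (A n) (B n) (\<Lambda> n) (\<Gamma> n)
      = A n powr (\<alpha> - 1/2) * \<mu> n"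
    using eventually_le[OF ratio_lims(1) ratio_lims(3)] eventually_le[OF ratio_lims(2) ratio_lims(4)]
  proof eventually_elim
    case (elim n)
    have tele: "(\<Sum>k=x..y. real k powr - \<alpha>) = \<Phi> (Suc y) - \<Phi> x" if "x \<le> y" for x y
      using sum.atLeastLessThan_concat[of 0 x "Suc y" "\<lambda>k. real k powr - \<alpha>"] that
      by (simp add: \<Phi>_def lessThan_atLeast0 atLeastLessThanSuc_atLeastAtMost del: sum.op_ivl_Suc sum.lessThan_Suc)
    have AB: "A n > 0" "B n > 0" using A_pos B_pos by auto
    have "sqrt ((A n / B n) powr (2 * \<alpha> - 1)) = (A n / B n) powr (\<alpha> - 1/2)"
      by (rule sqrt_powr_double_minus_1)
    hence r: "sqrt ((A n / B n) powr (2 * \<alpha> - 1)) * B n powr (\<alpha> - 1/2) = A n powr (\<alpha> - 1/2)"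
      using AB by (simp add: powr_divide)
    have rule1: "x * (2 * l * y) = 2 * (l / z)" if "x * y = inverse z" for x y z l :: real
      using that by (metis divide_inverse mult.assoc mult.left_commute)
    have rule2: "x * (2 * l * y) = 2 * (l / (w * z))" if "x = inverse z" "y = inverse w" for x y z w l :: real
      unfolding that by (simp add: field_simps)
    have s1: "A n powr (\<alpha> - 1/2) * (2 * \<Lambda> n * A n powr - \<alpha>) = 2 * (\<Lambda> n / A n powr (1/2))"
      by (rule rule1, unfold powr_add [symmetric] powr_minus [symmetric]) simp
    have s2: "A n powr (\<alpha> - 1/2) * (2 * \<Gamma> n * B n powr - \<alpha>) = 2 * (\<Gamma> n / (B n powr \<alpha> * A n powr (1/2 - \<alpha>)))"
      by (rule rule2, unfold powr_minus [symmetric]) simp_all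
    have "sqrt ((A n / B n) powr (2 * \<alpha> - 1)) * e2 n = A n powr (\<alpha> - 1/2) * (\<Phi> (Suc (c n)) - \<Phi> (Suc (d n)) - 2 * \<Gamma> n * B n powr - \<alpha>)"
      unfolding e2_def mult.assoc [symmetric] r by (simp add: c d)
    moreover have "e1 n = A n powr (\<alpha> - 1/2) * (\<Phi> (a n) - \<Phi> (b n) - 2 * \<Lambda> n * A n powr - \<alpha>)"
      unfolding e1_def by (simp add: a b)
    moreover have "\<mu> n = \<Phi> (Suc (c n)) - \<Phi> (Suc (d n)) - (\<Phi> (a n) - \<Phi> (b n))"
      unfolding \<mu>_def using elim by (simp add: tele)
    ultimately have "sqrt ((A n / B n) powr (2 * \<alpha> - 1)) * e2 n - e1 n
        = A n powr (\<alpha> - 1/2) * \<mu> n - A n powr (\<alpha> - 1/2) * (2 * \<Gamma> n * B n powr - \<alpha>)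
          + A n powr (\<alpha> - 1/2) * (2 * \<Lambda> n * A n powr - \<alpha>)"
      by (simp only: right_diff_distrib)
    hence diff: "sqrt ((A n / B n) powr (2 * \<alpha> - 1)) * e2 n - e1 n = A n powr (\<alpha> - 1/2) * \<mu> n
        - 2 * (\<Gamma> n / (B n powr \<alpha> * A n powr (1/2 - \<alpha>))) + 2 * (\<Lambda> n / A n powr (1/2))"
      unfolding s1 s2 .
    have rule3: "x - 2 * (l - g) = m" if "x = m - 2 * g + 2 * l" for x m g l :: real
      using that by simp
    show ?case
      unfolding bingo_deviation_def by (rule rule3[OF diff])
  qed
  ultimately have "(\<lambda>n. A n powr (\<alpha> - 1/2) * \<mu> n) \<longlonglongrightarrow> sqrt \<rho> * 0 - 0 - 2 * D"
    by (rule Lim_transform_eventually)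
  thus ?thesis by simp
qed

lemma norm_integral_lim:
  "(\<lambda>n. norm (complex_of_real (sqrt (V n)) * bingo_integral \<alpha> (a n) (b n) (c n) (d n)
         - complex_of_real (sqrt (2 * pi) * exp (- ((\<mu> n)\<^sup>2 / (2 * V n)))))) \<longlonglongrightarrow> 0"
proof -
  let ?W = "2 * (1 - \<rho>) / (2 * \<alpha> - 1)"
  have W: "?W > 0" using \<rho>_less_1 \<alpha> by simp
  \<comment> \<open>As k^(-\<alpha>) decreases, every rate is at most that of its starting level;
    the sum of both bounds them all. Relative to sqrt V this has order A^(-1/2).\<close>
  define e where "e n = real (a n) powr - \<alpha> + real (b n) powr - \<alpha>" for n
  define \<delta> where "\<delta> n = e n / sqrt (V n)" for n
  have V_nonneg: "V n \<ge> 0" for n unfolding V_def by (intro add_nonneg_nonneg sum_nonneg) auto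
  have \<delta>_nonneg: "\<delta> n \<ge> 0" for n by (simp add: \<delta>_def e_def V_nonneg)
  have V_pos: "\<forall>\<^sub>F n in sequentially. V n > 0"
    using order_tendstoD(1)[OF V_lim W] by eventually_elim (simp add: zero_less_mult_iff)
  have "(\<lambda>n. (A n powr - (- \<alpha>) * real (a n) powr - \<alpha> + A n powr - (- \<alpha>) * real (b n) powr - \<alpha>) * inverse (sqrt (A n))
      / sqrt (A n powr (2 * \<alpha> - 1) * V n)) \<longlonglongrightarrow> (1 + 1) * 0 / sqrt ?W"
    using W by (intro tendsto_divide tendsto_mult tendsto_add tendsto_ratio_powr A_at_top ratio_lims tendsto_real_sqrt V_lim
      tendsto_inverse_0_at_top filterlim_compose[OF sqrt_at_top A_at_top]) auto
  moreover have "(A n powr - (- \<alpha>) * real (a n) powr - \<alpha> + A n powr - (- \<alpha>) * real (b n) powr - \<alpha>) * inverse (sqrt (A n))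
      / sqrt (A n powr (2 * \<alpha> - 1) * V n) = \<delta> n" for n
  proof -
    have "A n powr \<alpha> * inverse (sqrt (A n)) = A n powr (\<alpha> - 1/2)"
      by (rule powr_minus_half[OF A_pos])
    moreover have "sqrt (A n powr (2 * \<alpha> - 1) * V n) = A n powr (\<alpha> - 1/2) * sqrt (V n)"
      by (simp add: real_sqrt_mult sqrt_powr_double_minus_1)
    moreover have "(A n powr - (- \<alpha>) * real (a n) powr - \<alpha> + A n powr - (- \<alpha>) * real (b n) powr - \<alpha>) * inverse (sqrt (A n))
       = (A n powr \<alpha> * inverse (sqrt (A n))) * e n"
      by (simp add: e_def algebra_simps)
    ultimately show ?thesis using A_pos[of n] by (simp add: \<delta>_def)
  qed
  ultimately have \<delta>_lim: "\<delta> \<longlonglongrightarrow> 0" by simp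
  have \<delta>_small: "\<forall>\<^sub>F n in sequentially. \<delta> n < 1/2"
    by (rule order_tendstoD(2)[OF \<delta>_lim]) simp
  show ?thesis
  proof (rule Lim_null_comparison[OF _ gaussian_error_tendsto_0[OF \<delta>_nonneg \<delta>_lim]])
    show "\<forall>\<^sub>F n in sequentially. norm (norm (complex_of_real (sqrt (V n)) * bingo_integral \<alpha> (a n) (b n) (c n) (d n)
         - complex_of_real (sqrt (2 * pi) * exp (- ((\<mu> n)\<^sup>2 / (2 * V n)))))) \<le> gaussian_error (\<delta> n)"
      using V_pos \<delta>_small
    proof eventually_elim
      case (elim n)
      let ?I = "{a n..c n} <+> {b n..d n}"
      have sq: "(x powr - \<alpha>)\<^sup>2 = x powr - (2 * \<alpha>)" for x
        by (simp add: power2_eq_square powr_add [symmetric])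
      have \<mu>: "(\<Sum>i\<in>?I. signed_rate \<alpha> i) = \<mu> n"
        by (simp add: sum.Plus \<mu>_def sum_negf)
      have "norm (complex_of_real (sqrt (V n)) * (LINT s|lborel. exp_char_prod (signed_rate \<alpha>) ?I s)
           - complex_of_real (sqrt (2 * pi) * exp (- ((\<Sum>i\<in>?I. signed_rate \<alpha> i)\<^sup>2 / (2 * V n))))) \<le> gaussian_error (\<delta> n)"
      proof (rule integral_exp_char_prod_approx)
        show "V n = (\<Sum>i\<in>?I. (signed_rate \<alpha> i)\<^sup>2)" by (simp add: sum.Plus V_def sq)
        have "(\<delta> n)\<^sup>2 \<le> (1/2)\<^sup>2" using elim \<delta>_nonneg[of n] by (intro power_mono) auto
        thus "(\<delta> n)\<^sup>2 \<le> 1 / 2" by (simp add: power2_eq_square)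
        fix i assume i: "i \<in> ?I"
        have mono: "real k powr - \<alpha> \<le> real l powr - \<alpha>" if "l \<le> k" "l \<ge> 1" for k l
          using that \<alpha> by (intro powr_mono2') auto
        have "\<bar>signed_rate \<alpha> i\<bar> \<le> e n"
          using i mono[of "a n"] mono[of "b n"] ge_1[of n] by (auto simp: e_def intro: add_increasing add_increasing2)
        thus "\<bar>signed_rate \<alpha> i\<bar> \<le> \<delta> n * sqrt (V n)" using elim by (simp add: \<delta>_def)
      qed (use elim \<delta>_nonneg in auto)
      thus ?case unfolding \<mu> bingo_integral_def by simp
    qed
  qed
qed

text \<open>The prefactor is about 2 B^(-\<alpha>) / (2 pi), and the integral is about sqrt (2 pi /
  V) exp (-\<mu>^2 / (2 V)) with V of order A^(1-2\<alpha>); the scaling removes exactly these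
  powers.\<close>

lemma BINGO_prob_scaled_lim:
  "(\<lambda>n. B n powr \<alpha> * A n powr (1/2 - \<alpha>) * BINGO_prob \<alpha> (a n) (b n) (c n) (d n))
     \<longlonglongrightarrow> sqrt ((2 * \<alpha> - 1) / pi) / sqrt (1 - \<rho>) * exp (- (2 * \<alpha> - 1) / (1 - \<rho>) * D\<^sup>2)"
proof -
  let ?W = "2 * (1 - \<rho>) / (2 * \<alpha> - 1)"
  have W: "?W > 0" using \<rho>_less_1 \<alpha> by simp
  have V_pos: "\<forall>\<^sub>F n in sequentially. V n > 0"
    using order_tendstoD(1)[OF V_lim W] by eventually_elim (simp add: zero_less_mult_iff)
  have expo: "(\<lambda>n. (\<mu> n)\<^sup>2 / (2 * V n)) \<longlonglongrightarrow> (- 2 * D)\<^sup>2 / (2 * ?W)"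
  proof -
    have "(\<lambda>n. (A n powr (\<alpha> - 1/2) * \<mu> n)\<^sup>2 / (2 * (A n powr (2 * \<alpha> - 1) * V n))) \<longlonglongrightarrow> (- 2 * D)\<^sup>2 / (2 * ?W)"
      using W by (intro tendsto_intros \<mu>_lim V_lim) auto
    moreover have "(A n powr (\<alpha> - 1/2) * \<mu> n)\<^sup>2 / (2 * (A n powr (2 * \<alpha> - 1) * V n)) = (\<mu> n)\<^sup>2 / (2 * V n)" for n
    proof -
      have "(A n powr (\<alpha> - 1/2))\<^sup>2 = A n powr (2 * \<alpha> - 1)"
        by (simp add: power2_eq_square powr_add [symmetric])
      thus ?thesis using A_pos[of n] by (simp add: power_mult_distrib)
    qed
    ultimately show ?thesis by simp
  qed
  define J where "J n = bingo_integral \<alpha> (a n) (b n) (c n) (d n)" for n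
  define g where "g n = sqrt (2 * pi) * exp (- ((\<mu> n)\<^sup>2 / (2 * V n)))" for n
  have g: "g \<longlonglongrightarrow> sqrt (2 * pi) * exp (- ((- 2 * D)\<^sup>2 / (2 * ?W)))"
    unfolding g_def by (intro tendsto_intros expo)
  \<comment> \<open>The probability is real, so the real part of the integral suffices.\<close>
  have "(\<lambda>n. Re (complex_of_real (sqrt (V n)) * J n - complex_of_real (g n))) \<longlonglongrightarrow> Re 0"
    using norm_integral_lim unfolding J_def g_def tendsto_norm_zero_iff by (intro tendsto_Re)
  hence "(\<lambda>n. Re (complex_of_real (sqrt (V n)) * J n - complex_of_real (g n)) + g n)
      \<longlonglongrightarrow> Re 0 + sqrt (2 * pi) * exp (- ((- 2 * D)\<^sup>2 / (2 * ?W)))"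
    using g by (intro tendsto_add)
  hence VJ: "(\<lambda>n. sqrt (V n) * Re (J n)) \<longlonglongrightarrow> sqrt (2 * pi) * exp (- ((- 2 * D)\<^sup>2 / (2 * ?W)))"
    by simp
  have "(\<lambda>n. (B n powr - (- \<alpha>) * real (c n) powr - \<alpha> + B n powr - (- \<alpha>) * real (d n) powr - \<alpha>) / (2 * pi)
       * ((sqrt (V n) * Re (J n)) / sqrt (A n powr (2 * \<alpha> - 1) * V n)))
     \<longlonglongrightarrow> (1 + 1) / (2 * pi) * ((sqrt (2 * pi) * exp (- ((- 2 * D)\<^sup>2 / (2 * ?W)))) / sqrt ?W)"
    using W by (intro tendsto_divide tendsto_mult tendsto_add tendsto_ratio_powr B_at_top ratio_lims tendsto_real_sqrt V_lim VJ tendsto_const) auto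
  hence "(\<lambda>n. B n powr \<alpha> * A n powr (1/2 - \<alpha>) * BINGO_prob \<alpha> (a n) (b n) (c n) (d n))
     \<longlonglongrightarrow> (1 + 1) / (2 * pi) * ((sqrt (2 * pi) * exp (- ((- 2 * D)\<^sup>2 / (2 * ?W)))) / sqrt ?W)"
  proof (rule Lim_transform_eventually)
    show "\<forall>\<^sub>F n in sequentially. (B n powr - (- \<alpha>) * real (c n) powr - \<alpha> + B n powr - (- \<alpha>) * real (d n) powr - \<alpha>) / (2 * pi)
         * ((sqrt (V n) * Re (J n)) / sqrt (A n powr (2 * \<alpha> - 1) * V n))
        = B n powr \<alpha> * A n powr (1/2 - \<alpha>) * BINGO_prob \<alpha> (a n) (b n) (c n) (d n)"
      using V_pos eventually_le[OF ratio_lims(1) ratio_lims(3)] eventually_le[OF ratio_lims(2) ratio_lims(4)]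
    proof eventually_elim
      case (elim n)
      have "BINGO_prob \<alpha> (a n) (b n) (c n) (d n) = Re (complex_of_real (BINGO_prob \<alpha> (a n) (b n) (c n) (d n)))" by simp
      also have "\<dots> = (real (c n) powr - \<alpha> + real (d n) powr - \<alpha>) / (2 * pi) * Re (J n)"
        using \<alpha> ge_1 elim unfolding J_def by (subst BINGO_prob_eq_integral) auto
      finally have P: "BINGO_prob \<alpha> (a n) (b n) (c n) (d n) = (real (c n) powr - \<alpha> + real (d n) powr - \<alpha>) / (2 * pi) * Re (J n)" .
      have "sqrt (A n powr (2 * \<alpha> - 1) * V n) = A n powr (\<alpha> - 1/2) * sqrt (V n)"
        by (simp add: real_sqrt_mult sqrt_powr_double_minus_1)
      hence "(sqrt (V n) * Re (J n)) / sqrt (A n powr (2 * \<alpha> - 1) * V n) = inverse (A n powr (\<alpha> - 1/2)) * Re (J n)"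
        using A_pos[of n] elim by (simp add: inverse_eq_divide)
      also have "inverse (A n powr (\<alpha> - 1/2)) = A n powr (1/2 - \<alpha>)"
        by (simp add: powr_minus [symmetric])
      finally have J: "(sqrt (V n) * Re (J n)) / sqrt (A n powr (2 * \<alpha> - 1) * V n) = A n powr (1/2 - \<alpha>) * Re (J n)" .
      have "(x * u + x * v) / (2 * pi) * (p * j) = x * p * ((u + v) / (2 * pi) * j)" for x u v p j :: real
        by (simp add: field_simps)
      thus ?case unfolding P J by simp
    qed
  qed
  moreover have "(1 + 1) / (2 * pi) * ((sqrt (2 * pi) * exp (- ((- 2 * D)\<^sup>2 / (2 * ?W)))) / sqrt ?W)
     = sqrt ((2 * \<alpha> - 1) / pi) / sqrt (1 - \<rho>) * exp (- (2 * \<alpha> - 1) / (1 - \<rho>) * D\<^sup>2)"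
  proof -
    have expo_eq: "- ((- 2 * D)\<^sup>2 / (2 * ?W)) = - (2 * \<alpha> - 1) / (1 - \<rho>) * D\<^sup>2"
      using \<rho>_less_1 \<alpha> by (simp add: field_simps)
    have "(1 + 1) / (2 * pi) * (sqrt (2 * pi) / sqrt ?W) = sqrt ((2 * \<alpha> - 1) / pi) / sqrt (1 - \<rho>)"
    proof -
      have "((1 + 1) / (2 * pi) * (sqrt (2 * pi) / sqrt ?W))\<^sup>2 = (sqrt ((2 * \<alpha> - 1) / pi) / sqrt (1 - \<rho>))\<^sup>2"
        using W \<rho>_less_1 \<alpha> by (simp add: power_mult_distrib power_divide) (simp add: field_simps power2_eq_square)
      thus ?thesis by (rule power2_eq_imp_eq) (use W \<rho>_less_1 \<alpha> in auto)
    qed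
    thus ?thesis unfolding expo_eq by (metis (no_types, lifting) mult.assoc times_divide_eq_left)
  qed
  ultimately show ?thesis by (simp only:)
qed

lemma bingo_main_scaled_lim:
  "(\<lambda>n. B n powr \<alpha> * A n powr (1/2 - \<alpha>) * bingo_main \<alpha> (A n) (B n) (\<Lambda> n) (\<Gamma> n))
     \<longlonglongrightarrow> sqrt ((2 * \<alpha> - 1) / pi) / sqrt (1 - \<rho>) * exp (- (2 * \<alpha> - 1) / (1 - \<rho>) * D\<^sup>2)"
proof -
  have "(\<lambda>n. sqrt ((2 * \<alpha> - 1) / pi) / sqrt (1 - (A n / B n) powr (2 * \<alpha> - 1)) *
      exp (- (2 * \<alpha> - 1) / (1 - (A n / B n) powr (2 * \<alpha> - 1)) * (bingo_deviation \<alpha> (A n) (B n) (\<Lambda> n) (\<Gamma> n))\<^sup>2))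
     \<longlonglongrightarrow> sqrt ((2 * \<alpha> - 1) / pi) / sqrt (1 - \<rho>) * exp (- (2 * \<alpha> - 1) / (1 - \<rho>) * D\<^sup>2)"
    using \<rho>_less_1 by (intro tendsto_intros \<rho>_lim D_lim) auto
  moreover have "B n powr \<alpha> * A n powr (1/2 - \<alpha>) * bingo_main \<alpha> (A n) (B n) (\<Lambda> n) (\<Gamma> n) =
      sqrt ((2 * \<alpha> - 1) / pi) / sqrt (1 - (A n / B n) powr (2 * \<alpha> - 1)) *
      exp (- (2 * \<alpha> - 1) / (1 - (A n / B n) powr (2 * \<alpha> - 1)) * (bingo_deviation \<alpha> (A n) (B n) (\<Lambda> n) (\<Gamma> n))\<^sup>2)" for n
  proof -
    have "A n powr (1/2 - \<alpha>) * A n powr (\<alpha> - 1/2) = 1"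
      using A_pos[of n] by (simp add: powr_add [symmetric])
    moreover have "x * y * (s * z / (x * t) * w) = (y * z) * (s / t * w)" if "x > 0" for x y z s t w :: real
      using that by simp
    ultimately show ?thesis
      unfolding bingo_main_def using B_pos[of n] by simp
  qed
  ultimately show ?thesis by simp
qed

text \<open>Both scaled quantities share the limit \<open>L\<close>, and its positivity permits
  passing to the relative error.\<close>

theorem BINGO_prob_ratio_lim:
  "(\<lambda>n. \<bar>BINGO_prob \<alpha> (a n) (b n) (c n) (d n) - bingo_main \<alpha> (A n) (B n) (\<Lambda> n) (\<Gamma> n)\<bar>
       / bingo_main \<alpha> (A n) (B n) (\<Lambda> n) (\<Gamma> n)) \<longlonglongrightarrow> 0"
proof -
  define s where "s n = B n powr \<alpha> * A n powr (1/2 - \<alpha>)" for n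
  define P m where "P n = BINGO_prob \<alpha> (a n) (b n) (c n) (d n)" and "m n = bingo_main \<alpha> (A n) (B n) (\<Lambda> n) (\<Gamma> n)" for n
  define L where "L = sqrt ((2 * \<alpha> - 1) / pi) / sqrt (1 - \<rho>) * exp (- (2 * \<alpha> - 1) / (1 - \<rho>) * D\<^sup>2)"
  have L: "L > 0" using \<alpha> \<rho>_less_1 by (simp add: L_def)
  have s: "s n > 0" for n using A_pos[of n] B_pos[of n] by (simp add: s_def)
  have "(\<lambda>n. \<bar>s n * P n - s n * m n\<bar> / (s n * m n)) \<longlonglongrightarrow> \<bar>L - L\<bar> / L"
    using BINGO_prob_scaled_lim bingo_main_scaled_lim L
    unfolding s_def P_def m_def L_def [symmetric]
    by (intro tendsto_divide tendsto_rabs tendsto_diff) auto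
  moreover have "\<bar>s n * P n - s n * m n\<bar> / (s n * m n) = \<bar>P n - m n\<bar> / m n" for n
  proof -
    have "\<bar>s n * P n - s n * m n\<bar> = s n * \<bar>P n - m n\<bar>"
      using s[of n] unfolding right_diff_distrib [symmetric] abs_mult by simp
    thus ?thesis using s[of n] by simp
  qed
  ultimately have "(\<lambda>n. \<bar>P n - m n\<bar> / m n) \<longlonglongrightarrow> \<bar>L - L\<bar> / L" by (simp only:)
  thus ?thesis by (simp add: P_def m_def)
qed

end

section \<open>Uniformity\<close>

lemma bingo_main_pos:
  assumes "\<alpha> > 1" "\<theta> > 1" "A > 0" "B \<ge> \<theta> * A"
  shows "bingo_main \<alpha> A B \<Lambda> \<Gamma> > 0"
proof -
  have "B > 0" using assms by (smt (verit) mult_pos_pos)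
  moreover have "(A / B) powr (2 * \<alpha> - 1) < 1"
    using ratio_powr_le[OF assms(2-4), of "2 * \<alpha> - 1"] assms by linarith
  ultimately show ?thesis using assms by (simp add: bingo_main_def)
qed

text \<open>All dependence on B is isolated in B^(-\<alpha>): the square root in the denominator is
  at most 1, and the exponent is bounded by the extreme values of the deviation and of
  (A/B)^(2\<alpha>-1).\<close>

lemma bingo_main_ge:
  assumes "\<alpha> > 1" "M > 0" "\<theta> > 1" "A > 0" "B \<ge> \<theta> * A" "\<bar>\<Lambda>\<bar> \<le> M * sqrt A" "\<bar>\<Gamma>\<bar> \<le> M * sqrt B"
  shows "bingo_main \<alpha> A B \<Lambda> \<Gamma> \<ge> sqrt ((2 * \<alpha> - 1) / pi) * A powr (\<alpha> - 1/2)
    * exp (- (2 * \<alpha> - 1) / (1 - \<theta> powr - (2 * \<alpha> - 1)) * (2 * M)\<^sup>2) * B powr - \<alpha>"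
proof -
  define \<rho> where "\<rho> = (A / B) powr (2 * \<alpha> - 1)"
  define D where "D = bingo_deviation \<alpha> A B \<Lambda> \<Gamma>"
  define \<rho>0 where "\<rho>0 = \<theta> powr - (2 * \<alpha> - 1)"
  have \<rho>: "\<rho> \<le> \<rho>0" "\<rho>0 < 1" "\<rho> \<ge> 0"
    using ratio_powr_le[OF assms(3-5), of "2 * \<alpha> - 1"] assms(1) by (auto simp: \<rho>_def \<rho>0_def)
  have AB: "B \<ge> A" using assms by (smt (verit) mult_le_cancel_right1)
  have "\<bar>D\<bar> \<le> \<bar>2 * M\<bar>"
    unfolding D_def using bingo_deviation_bound[OF assms(1,2,4) AB assms(6,7)] assms(2) by simp
  hence "D\<^sup>2 \<le> (2 * M)\<^sup>2" by (simp only: abs_le_square_iff)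
  hence "(2 * \<alpha> - 1) / (1 - \<rho>) * D\<^sup>2 \<le> (2 * \<alpha> - 1) / (1 - \<rho>0) * (2 * M)\<^sup>2"
    using \<rho> assms(1) by (intro mult_mono divide_left_mono) auto
  hence "exp (- (2 * \<alpha> - 1) / (1 - \<rho>0) * (2 * M)\<^sup>2) \<le> exp (- (2 * \<alpha> - 1) / (1 - \<rho>) * D\<^sup>2)"
    by (simp only: exp_le_cancel_iff minus_divide_left [symmetric] mult_minus_left neg_le_iff_le)
  moreover have "sqrt ((2 * \<alpha> - 1) / pi) * A powr (\<alpha> - 1/2) * B powr - \<alpha> \<le>
      sqrt ((2 * \<alpha> - 1) / pi) * A powr (\<alpha> - 1/2) / (B powr \<alpha> * sqrt (1 - \<rho>))"
  proof -
    have "B powr - \<alpha> = 1 / B powr \<alpha>" by (simp add: powr_minus_divide)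
    also have "\<dots> \<le> 1 / (B powr \<alpha> * sqrt (1 - \<rho>))"
      using \<rho> AB assms by (intro divide_left_mono) (auto simp: mult_le_cancel_left1)
    finally have "sqrt ((2 * \<alpha> - 1) / pi) * A powr (\<alpha> - 1/2) * B powr - \<alpha> \<le>
      sqrt ((2 * \<alpha> - 1) / pi) * A powr (\<alpha> - 1/2) * (1 / (B powr \<alpha> * sqrt (1 - \<rho>)))"
      using assms by (intro mult_left_mono) auto
    thus ?thesis by simp
  qed
  ultimately have "sqrt ((2 * \<alpha> - 1) / pi) * A powr (\<alpha> - 1/2) * B powr - \<alpha> * exp (- (2 * \<alpha> - 1) / (1 - \<rho>0) * (2 * M)\<^sup>2)
     \<le> sqrt ((2 * \<alpha> - 1) / pi) * A powr (\<alpha> - 1/2) / (B powr \<alpha> * sqrt (1 - \<rho>)) * exp (- (2 * \<alpha> - 1) / (1 - \<rho>) * D\<^sup>2)"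
    using assms \<rho> AB by (intro mult_mono) auto
  thus ?thesis
    unfolding bingo_main_def \<rho>_def [symmetric] \<rho>0_def [symmetric] D_def [symmetric] by (simp only: mult_ac)
qed

text \<open>Only the factors of the two starting levels are kept, so the bound does not involve c
  and d.\<close>

lemma norm_bingo_integral_le:
  assumes "\<alpha> > 0" "a \<ge> 1" "b \<ge> 1" "a \<le> c" "b \<le> d" "real a \<le> R" "real b \<le> R"
  shows "norm (bingo_integral \<alpha> a b c d) \<le> (LINT s|lborel. 1 / (1 + (R powr - \<alpha>)\<^sup>2 * s\<^sup>2))"
proof -
  let ?I = "{a..c} <+> {b..d}"
  have R: "R > 0" using assms by linarith
  have mono: "R powr - \<alpha> \<le> real k powr - \<alpha>" if "real k \<le> R" "k \<ge> 1" for k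
    using that assms(1) by (intro powr_mono2') auto
  have le: "norm (exp_char_prod (signed_rate \<alpha>) ?I s) \<le> 1 / (1 + (R powr - \<alpha>)\<^sup>2 * s\<^sup>2)" for s
    by (rule norm_exp_char_prod_le[where i = "Inl a" and j = "Inr b"]) (use assms R mono in auto)
  have int: "integrable lborel (exp_char_prod (signed_rate \<alpha>) ?I)"
    by (rule integrable_exp_char_prod) (use assms in \<open>auto simp: card_Plus\<close>)
  have "norm (bingo_integral \<alpha> a b c d) \<le> (LINT s|lborel. norm (exp_char_prod (signed_rate \<alpha>) ?I s))"
    unfolding bingo_integral_def by (rule integral_norm_bound)
  also have "\<dots> \<le> (LINT s|lborel. 1 / (1 + (R powr - \<alpha>)\<^sup>2 * s\<^sup>2))"
    by (rule Bochner_Integration.integral_mono[OF integrable_norm[OF int] integrable_inverse_1_plus_mult_square le])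
       (use R in auto)
  finally show ?thesis .
qed

text \<open>If sqrt B is at least 2M, then |\<Gamma>| is at most B/2 and x at least B/2; otherwise B
  is below 4M^2 and x is at least 1. The constant 2 + 4M^2 covers both cases.\<close>

lemma endpoint_powr_le:
  assumes "\<alpha> > 0" "M > 0" "B > 0" "\<bar>\<Gamma>\<bar> \<le> M * sqrt B" "x \<ge> 1" "x \<ge> B - \<bar>\<Gamma>\<bar>"
  shows "x powr - \<alpha> \<le> (2 + 4 * M\<^sup>2) powr \<alpha> * B powr - \<alpha>"
proof -
  have "B \<le> (2 + 4 * M\<^sup>2) * x"
  proof (cases "2 * M \<le> sqrt B")
    case True
    hence "2 * M * sqrt B \<le> sqrt B * sqrt B" using assms by (intro mult_right_mono) auto
    hence "B \<le> 2 * x" using assms by simp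
    also have "\<dots> \<le> (2 + 4 * M\<^sup>2) * x" using assms by (intro mult_right_mono) auto
    finally show ?thesis .
  next
    case False
    hence "(sqrt B)\<^sup>2 \<le> (2 * M)\<^sup>2" using assms by (intro power_mono) auto
    hence "B \<le> 4 * M\<^sup>2" using assms by (simp add: power_mult_distrib)
    also have "\<dots> \<le> (2 + 4 * M\<^sup>2) * 1" by simp
    also have "\<dots> \<le> (2 + 4 * M\<^sup>2) * x" using assms by (intro mult_left_mono) auto
    finally show ?thesis .
  qed
  moreover have "2 + 4 * M\<^sup>2 > 0" by (simp add: add_pos_nonneg)
  ultimately have "B / (2 + 4 * M\<^sup>2) \<le> x" by (simp add: pos_divide_le_eq mult.commute)
  hence "x powr - \<alpha> \<le> (B / (2 + 4 * M\<^sup>2)) powr - \<alpha>"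
    using assms \<open>2 + 4 * M\<^sup>2 > 0\<close> by (intro powr_mono2') auto
  also have "\<dots> = (2 + 4 * M\<^sup>2) powr \<alpha> * B powr - \<alpha>"
    using assms \<open>2 + 4 * M\<^sup>2 > 0\<close> by (simp add: powr_divide powr_minus field_simps)
  finally show ?thesis .
qed

text \<open>Integrality and the lower bounds 1 make the conversions by \<open>nat\<close> and floor
  exact.\<close>

definition bingo_admissible :: "real \<Rightarrow> real \<Rightarrow> real \<Rightarrow> real \<Rightarrow> real \<Rightarrow> real \<Rightarrow> bool" where
  "bingo_admissible M \<theta> A B \<Lambda> \<Gamma> \<longleftrightarrow>
     A + \<Lambda> \<in> \<int> \<and> A - \<Lambda> \<in> \<int> \<and> B + \<Gamma> \<in> \<int> \<and> B - \<Gamma> \<in> \<int> \<and>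
     A > 0 \<and> B \<ge> \<theta> * A \<and> \<bar>\<Lambda>\<bar> \<le> M * sqrt A \<and> \<bar>\<Gamma>\<bar> \<le> M * sqrt B \<and>
     A + \<Lambda> \<ge> 1 \<and> A - \<Lambda> \<ge> 1 \<and> B + \<Gamma> \<ge> 1 \<and> B - \<Gamma> \<ge> 1"

definition bingo_relative_error :: "real \<Rightarrow> real \<Rightarrow> real \<Rightarrow> real \<Rightarrow> real \<Rightarrow> real" where
  "bingo_relative_error \<alpha> A B \<Lambda> \<Gamma> =
     \<bar>BINGO_prob \<alpha> (nat \<lfloor>A + \<Lambda>\<rfloor>) (nat \<lfloor>A - \<Lambda>\<rfloor>) (nat \<lfloor>B + \<Gamma>\<rfloor>) (nat \<lfloor>B - \<Gamma>\<rfloor>) - bingo_main \<alpha> A B \<Lambda> \<Gamma>\<bar>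
       / bingo_main \<alpha> A B \<Lambda> \<Gamma>"

lemma nat_floor_ge_1:
  assumes "x \<in> \<int>" "x \<ge> (1::real)"
  shows "real (nat \<lfloor>x\<rfloor>) = x" "Suc 0 \<le> nat \<lfloor>x\<rfloor>"
  using assms by (auto elim!: Ints_cases)

text \<open>For fixed A, the probability is at most, and the main term at least, a constant times
  B^(-\<alpha>), so their quotient is bounded although B is not. This makes the supremum defining
  the error function finite.\<close>

lemma bingo_relative_error_bounded:
  assumes "\<alpha> > 1" "M > 0" "\<theta> > 1"
  shows "\<exists>C. \<forall>B \<Lambda> \<Gamma>. bingo_admissible M \<theta> A B \<Lambda> \<Gamma> \<longrightarrow> bingo_relative_error \<alpha> A B \<Lambda> \<Gamma> \<le> C"
proof (cases "A > 0")
  case False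
  thus ?thesis by (auto simp: bingo_admissible_def)
next
  case True
  \<comment> \<open>The starting coordinates are at least 1 and add up to 2A, so each is at most
    2A.\<close>
  define K where "K = (LINT s|lborel. 1 / (1 + ((2 * A) powr - \<alpha>)\<^sup>2 * s\<^sup>2))"
  define L where "L = sqrt ((2 * \<alpha> - 1) / pi) * A powr (\<alpha> - 1/2)
    * exp (- (2 * \<alpha> - 1) / (1 - \<theta> powr - (2 * \<alpha> - 1)) * (2 * M)\<^sup>2)"
  define U where "U = 2 * (2 + 4 * M\<^sup>2) powr \<alpha> / (2 * pi) * K"
  have K: "K \<ge> 0" unfolding K_def by (intro Bochner_Integration.integral_nonneg) (simp add: add_nonneg_nonneg)
  hence U: "U \<ge> 0" by (simp add: U_def)
  have L: "L > 0" using True assms by (simp add: L_def)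
  have "bingo_relative_error \<alpha> A B \<Lambda> \<Gamma> \<le> U / L + 1" if adm: "bingo_admissible M \<theta> A B \<Lambda> \<Gamma>" for B \<Lambda> \<Gamma>
  proof -
    define a b c d where "a = nat \<lfloor>A + \<Lambda>\<rfloor>" and "b = nat \<lfloor>A - \<Lambda>\<rfloor>" and "c = nat \<lfloor>B + \<Gamma>\<rfloor>" and "d = nat \<lfloor>B - \<Gamma>\<rfloor>"
    have eqs: "real a = A + \<Lambda>" "real b = A - \<Lambda>" "real c = B + \<Gamma>" "real d = B - \<Gamma>"
      and ge1: "a \<ge> 1" "b \<ge> 1" "c \<ge> 1" "d \<ge> 1"
      using adm unfolding a_def b_def c_def d_def bingo_admissible_def by (auto intro!: nat_floor_ge_1)
    have adm': "B \<ge> \<theta> * A" "\<bar>\<Lambda>\<bar> \<le> M * sqrt A" "\<bar>\<Gamma>\<bar> \<le> M * sqrt B"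
      using adm by (auto simp: bingo_admissible_def)
    have B: "B > 0" using adm'(1) True assms by (smt (verit) mult_pos_pos)
    have m_pos: "bingo_main \<alpha> A B \<Lambda> \<Gamma> > 0" by (rule bingo_main_pos) (use assms True adm' in auto)
    have "\<bar>BINGO_prob \<alpha> a b c d\<bar> \<le> U * B powr - \<alpha>"
    proof (cases "a \<le> c \<and> b \<le> d")
      \<comment> \<open>For small A the fluctuations can reverse the order of a start and an end
        coordinate; the probability is then 0.\<close>
      case False
      hence "complex_of_real (BINGO_prob \<alpha> a b c d) = 0"
        using BINGO_prob_eq_integral[of \<alpha> a b c d] assms ge1 by auto
      thus ?thesis using U by simp
    next
      case le: True
      have cd: "real c powr - \<alpha> + real d powr - \<alpha> \<le> 2 * ((2 + 4 * M\<^sup>2) powr \<alpha> * B powr - \<alpha>)"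
      proof -
        have "real c powr - \<alpha> \<le> (2 + 4 * M\<^sup>2) powr \<alpha> * B powr - \<alpha>" "real d powr - \<alpha> \<le> (2 + 4 * M\<^sup>2) powr \<alpha> * B powr - \<alpha>"
          by (rule endpoint_powr_le[OF _ assms(2) B adm'(3)]; use assms ge1 eqs in linarith)+
        thus ?thesis by linarith
      qed
      have "\<bar>BINGO_prob \<alpha> a b c d\<bar> = norm (complex_of_real (BINGO_prob \<alpha> a b c d))" by simp
      also have "\<dots> = (real c powr - \<alpha> + real d powr - \<alpha>) / (2 * pi) * norm (bingo_integral \<alpha> a b c d)"
        using assms ge1 le by (subst BINGO_prob_eq_integral) (auto simp: norm_mult norm_divide simp flip: of_real_add)
      also have "\<dots> \<le> 2 * ((2 + 4 * M\<^sup>2) powr \<alpha> * B powr - \<alpha>) / (2 * pi) * K"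
        unfolding K_def using assms ge1 le eqs cd
        by (intro mult_mono divide_right_mono norm_bingo_integral_le) auto
      finally show ?thesis by (simp add: U_def mult_ac)
    qed
    also have "\<dots> = U / L * (L * B powr - \<alpha>)" using L by simp
    also have "\<dots> \<le> U / L * bingo_main \<alpha> A B \<Lambda> \<Gamma>"
      unfolding L_def using U L True assms adm'
      by (intro mult_left_mono bingo_main_ge) (auto simp: L_def [symmetric])
    finally have "\<bar>BINGO_prob \<alpha> a b c d - bingo_main \<alpha> A B \<Lambda> \<Gamma>\<bar> \<le> (U / L + 1) * bingo_main \<alpha> A B \<Lambda> \<Gamma>"
      using m_pos by (simp add: distrib_right)
    thus ?thesis
      unfolding bingo_relative_error_def a_def b_def c_def d_def using m_pos by (simp add: pos_divide_le_eq)
  qed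
  thus ?thesis by blast
qed

lemma bingo_relative_error_small:
  assumes "\<alpha> > 1" "M > 0" "\<theta> > 1" "\<eta> > 0"
  shows "\<exists>N. \<forall>A B \<Lambda> \<Gamma>. A \<ge> N \<longrightarrow> bingo_admissible M \<theta> A B \<Lambda> \<Gamma> \<longrightarrow> bingo_relative_error \<alpha> A B \<Lambda> \<Gamma> \<le> \<eta>"
proof (rule ccontr)
  assume neg: "\<not> ?thesis"
  hence "\<forall>n::nat. \<exists>A B \<Lambda> \<Gamma>. A \<ge> real n \<and> bingo_admissible M \<theta> A B \<Lambda> \<Gamma> \<and> bingo_relative_error \<alpha> A B \<Lambda> \<Gamma> > \<eta>"
    by (meson not_le)
  then obtain A B \<Lambda> \<Gamma> where seq: "\<And>n. A n \<ge> real n" "\<And>n. bingo_admissible M \<theta> (A n) (B n) (\<Lambda> n) (\<Gamma> n)"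
    "\<And>n. bingo_relative_error \<alpha> (A n) (B n) (\<Lambda> n) (\<Gamma> n) > \<eta>"
    by metis
  \<comment> \<open>The parameters themselves are unbounded; these two combinations remain in a
    compact rectangle and determine the scaled limit.\<close>
  define f where "f n = ((A n / B n) powr (2 * \<alpha> - 1), bingo_deviation \<alpha> (A n) (B n) (\<Lambda> n) (\<Gamma> n))" for n
  have adm: "A n > 0" "B n \<ge> \<theta> * A n" "\<bar>\<Lambda> n\<bar> \<le> M * sqrt (A n)" "\<bar>\<Gamma> n\<bar> \<le> M * sqrt (B n)" for n
    using seq(2)[of n] by (auto simp: bingo_admissible_def)
  have "bounded (range f)"
  proof (rule bounded_subset[OF bounded_Times])
    show "bounded {0..1::real}" "bounded {-(2 * M)..2 * M}" by auto
    show "range f \<subseteq> {0..1} \<times> {-(2 * M)..2 * M}"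
    proof (rule image_subsetI)
      fix n
      have AB: "A n \<le> B n" using adm[of n] assms by (smt (verit) mult_le_cancel_right1)
      have "(A n / B n) powr (2 * \<alpha> - 1) \<le> 1"
        using ratio_powr_le[OF assms(3) adm(1,2)[of n], of "2 * \<alpha> - 1"] assms(1) by simp
      moreover have "\<bar>bingo_deviation \<alpha> (A n) (B n) (\<Lambda> n) (\<Gamma> n)\<bar> \<le> 2 * M"
        by (rule bingo_deviation_bound[OF assms(1,2) adm(1) AB adm(3,4)])
      ultimately show "f n \<in> {0..1} \<times> {-(2 * M)..2 * M}" by (auto simp: f_def)
    qed
  qed
  then obtain l r where r: "strict_mono r" "(f \<circ> r) \<longlonglongrightarrow> l"
    using bounded_imp_convergent_subsequence by blast
  interpret bingo_sequence \<alpha> M \<theta> "\<lambda>n. nat \<lfloor>A (r n) + \<Lambda> (r n)\<rfloor>" "\<lambda>n. nat \<lfloor>A (r n) - \<Lambda> (r n)\<rfloor>"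
    "\<lambda>n. nat \<lfloor>B (r n) + \<Gamma> (r n)\<rfloor>" "\<lambda>n. nat \<lfloor>B (r n) - \<Gamma> (r n)\<rfloor>"
    "\<lambda>n. A (r n)" "\<lambda>n. B (r n)" "\<lambda>n. \<Lambda> (r n)" "\<lambda>n. \<Gamma> (r n)" "fst l" "snd l"
  proof
    have "filterlim A at_top sequentially"
      by (rule filterlim_at_top_mono[OF filterlim_real_sequentially]) (simp add: seq(1))
    thus "filterlim (\<lambda>n. A (r n)) at_top sequentially"
      using filterlim_compose filterlim_subseq[OF r(1)] by blast
    show "(\<lambda>n. (A (r n) / B (r n)) powr (2 * \<alpha> - 1)) \<longlonglongrightarrow> fst l"
      using tendsto_fst[OF r(2)] by (simp add: f_def)
    show "(\<lambda>n. bingo_deviation \<alpha> (A (r n)) (B (r n)) (\<Lambda> (r n)) (\<Gamma> (r n))) \<longlonglongrightarrow> snd l"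
      using tendsto_snd[OF r(2)] by (simp add: f_def)
  qed (use seq(2) assms in \<open>auto simp: bingo_admissible_def intro!: nat_floor_ge_1\<close>)
  have "(\<lambda>n. bingo_relative_error \<alpha> (A (r n)) (B (r n)) (\<Lambda> (r n)) (\<Gamma> (r n))) \<longlonglongrightarrow> 0"
    using BINGO_prob_ratio_lim by (simp add: bingo_relative_error_def)
  from order_tendstoD(2)[OF this assms(4)]
  have "\<forall>\<^sub>F n in sequentially. bingo_relative_error \<alpha> (A (r n)) (B (r n)) (\<Lambda> (r n)) (\<Gamma> (r n)) < \<eta>" .
  then obtain n where "bingo_relative_error \<alpha> (A (r n)) (B (r n)) (\<Lambda> (r n)) (\<Gamma> (r n)) < \<eta>"
    by (auto simp: eventually_sequentially)
  with seq(3)[of "r n"] show False by simp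
qed

theorem mainTheorem9:
  fixes \<alpha> M \<theta> :: real
  assumes "\<alpha> > 1" and "M > 0" and "\<theta> > 1"
  shows "\<exists>\<epsilon> :: real \<Rightarrow> real. (\<epsilon> \<longlongrightarrow> 0) at_top \<and>
    (\<forall>A B \<Lambda> \<Gamma> :: real.
       2 * A \<in> \<int> \<and> 2 * B \<in> \<int> \<and> 2 * \<Lambda> \<in> \<int> \<and> 2 * \<Gamma> \<in> \<int> \<and>
       A + \<Lambda> \<in> \<int> \<and> A - \<Lambda> \<in> \<int> \<and> B + \<Gamma> \<in> \<int> \<and> B - \<Gamma> \<in> \<int> \<and>
       A > 0 \<and> B \<ge> \<theta> * A \<and> \<bar>\<Lambda>\<bar> \<le> M * sqrt A \<and> \<bar>\<Gamma>\<bar> \<le> M * sqrt B \<and>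
       A + \<Lambda> \<ge> 1 \<and> A - \<Lambda> \<ge> 1 \<and> B + \<Gamma> \<ge> 1 \<and> B - \<Gamma> \<ge> 1
     \<longrightarrow>
       (let main = sqrt ((2 * \<alpha> - 1) / pi) * A powr (\<alpha> - 1/2)
                   / (B powr \<alpha> * sqrt (1 - (A / B) powr (2 * \<alpha> - 1)))
                   * exp (- (2 * \<alpha> - 1) / (1 - (A / B) powr (2 * \<alpha> - 1))
                          * (\<Lambda> / A powr (1/2) - \<Gamma> / (B powr \<alpha> * A powr (1/2 - \<alpha>)))\<^sup>2)
        in \<bar>BINGO_prob \<alpha> (nat \<lfloor>A + \<Lambda>\<rfloor>) (nat \<lfloor>A - \<Lambda>\<rfloor>)
                           (nat \<lfloor>B + \<Gamma>\<rfloor>) (nat \<lfloor>B - \<Gamma>\<rfloor>) - main\<bar>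
           \<le> \<epsilon> A * main))"
proof -
  \<comment> \<open>Adjoining 0 keeps the set nonempty for those A that have no admissible
    parameters, and makes its supremum nonnegative.\<close>
  define E where "E A = insert 0 {bingo_relative_error \<alpha> A B \<Lambda> \<Gamma> |B \<Lambda> \<Gamma>. bingo_admissible M \<theta> A B \<Lambda> \<Gamma>}" for A
  define \<epsilon> where "\<epsilon> A = Sup (E A)" for A
  have bdd: "bdd_above (E A)" for A
  proof -
    obtain C where "\<And>B \<Lambda> \<Gamma>. bingo_admissible M \<theta> A B \<Lambda> \<Gamma> \<Longrightarrow> bingo_relative_error \<alpha> A B \<Lambda> \<Gamma> \<le> C"
      using bingo_relative_error_bounded[OF assms] by blast
    thus ?thesis unfolding E_def by (intro bdd_aboveI[of _ "max 0 C"]) (auto simp: le_max_iff_disj)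
  qed
  have upper: "bingo_relative_error \<alpha> A B \<Lambda> \<Gamma> \<le> \<epsilon> A" if "bingo_admissible M \<theta> A B \<Lambda> \<Gamma>" for A B \<Lambda> \<Gamma>
    unfolding \<epsilon>_def by (intro cSup_upper bdd) (use that in \<open>auto simp: E_def\<close>)
  have nonneg: "\<epsilon> A \<ge> 0" for A
    unfolding \<epsilon>_def by (intro cSup_upper bdd) (auto simp: E_def)
  have "(\<epsilon> \<longlongrightarrow> 0) at_top"
  proof (rule tendstoI)
    fix \<eta> :: real assume "\<eta> > 0"
    then obtain N where N: "\<And>A B \<Lambda> \<Gamma>. A \<ge> N \<Longrightarrow> bingo_admissible M \<theta> A B \<Lambda> \<Gamma> \<Longrightarrow> bingo_relative_error \<alpha> A B \<Lambda> \<Gamma> \<le> \<eta> / 2"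
      using bingo_relative_error_small[OF assms half_gt_zero] by blast
    have "dist (\<epsilon> A) 0 < \<eta>" if "A \<ge> N" for A
    proof -
      \<comment> \<open>A supremum inherits only a weak inequality, hence the margin from \<eta>/2
        to \<eta>.\<close>
      have "\<epsilon> A \<le> \<eta> / 2"
        unfolding \<epsilon>_def by (rule cSup_least) (use N[OF that] \<open>\<eta> > 0\<close> in \<open>auto simp: E_def\<close>)
      thus ?thesis using nonneg[of A] \<open>\<eta> > 0\<close> by simp
    qed
    thus "\<forall>\<^sub>F A in at_top. dist (\<epsilon> A) 0 < \<eta>"
      by (rule eventually_mono[OF eventually_ge_at_top[of N]])
  qed
  moreover have "\<bar>BINGO_prob \<alpha> (nat \<lfloor>A + \<Lambda>\<rfloor>) (nat \<lfloor>A - \<Lambda>\<rfloor>) (nat \<lfloor>B + \<Gamma>\<rfloor>) (nat \<lfloor>B - \<Gamma>\<rfloor>) - bingo_main \<alpha> A B \<Lambda> \<Gamma>\<bar>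
      \<le> \<epsilon> A * bingo_main \<alpha> A B \<Lambda> \<Gamma>" if "bingo_admissible M \<theta> A B \<Lambda> \<Gamma>" for A B \<Lambda> \<Gamma>
  proof -
    have "bingo_main \<alpha> A B \<Lambda> \<Gamma> > 0"
      by (rule bingo_main_pos[OF assms(1,3)]) (use that in \<open>auto simp: bingo_admissible_def\<close>)
    thus ?thesis using upper[OF that] by (simp add: bingo_relative_error_def pos_divide_le_eq)
  qed
  ultimately show ?thesis
    unfolding bingo_admissible_def bingo_main_def bingo_deviation_def Let_def
    by (intro exI[of _ \<epsilon>]) blast
qed

end
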